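(* Let $F$ and $G$ be Fréchet spaces, $U\subset F$ open, $g:U\to G$ a $C^1_F$-map, and $M\subset G$ a $C^1_F$-submanifold of finite codimension $m$. Assume that $g$ and $M$ are transversal at a point $x\in g^{-1}(M)$ in the sense that $$G=Dg(x)F+T_{g(x)}M.$$ Then there is an open neighbourhood $V$ of $x$ in $U$ so that $V\cap g^{-1}(M)$ is a $C^1_F$-submanifold of codimension $m$ in $F$, and $T_x(g^{-1}(M)\cap V)=Dg(x)^{-1}T_{g(x)}M$. In case $\dim G=m$, $M=\{g(x)\}$, and $Dg(x)$ is surjective, the assertion holds with $T_{g(x)}M=\{0\}$.
   Context: For topological vector spaces $V,W$, $L_c(V,W)$ denotes the vector space of continuous linear maps $V\to W$; the topology $\beta$ on $L_c(V,W)$ is that of uniform convergence on bounded sets (basic neighbourhoods of $0$: $\{A\in L_c(V,W): AB\subset N\}$ with $B\subset V$ bounded and $N$ a neighbourhood of $0$ in $W$). A continuous map $f:V\supset U\to W$, $U$ open, is $C^1_F$-smooth (a $C^1_F$-map) if all directional derivatives $Df(u)v=\lim_{0\ne t\to0}\frac1t(f(u+tv)-f(u))$, $u\in U$, $v\in V$, exist, each $Df(u):V\to W$ is linear and continuous, and $U\ni u\mapsto Df(u)\in L_c(V,W)$ is continuous with respect to $\beta$. A $C^1_F$-diffeomorphism is an injective $C^1_F$-map from an open subset of a Fréchet space onto an open subset of a Fréchet space with $C^1_F$-smooth inverse. A subset $M$ of a Fréchet space $F=G_0\oplus H_0$ ($G_0,H_0$ closed subspaces) is a $C^1_F$-submanifold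 (modelled over $G_0$) if for each $m\in M$ there are an open neighbourhood $O$ of $m$ in $F$ and a $C^1_F$-diffeomorphism $K$ from $O$ onto an open set $W\subset F$ with $K(M\cap O)=W\cap G_0$; its codimension is $\dim H_0$. The tangent space $T_mM$ is the set of all tangent vectors $c'(0)$ of continuously differentiable curves $c:I\to F$, $I$ an open interval containing $0$, with $c(0)=m$ and $c(I)\subset M$. $Dg(x)^{-1}S$ denotes the preimage of $S$ under $Dg(x)$. *)

theory Defs
  imports "HOL-Analysis.Analysis"
begin

section \<open>Topological vector spaces and Frechet spaces\<close>

class real_tvs = real_vector + topological_ab_group_add + t2_space +
  assumes tendsto_scaleR_Pair:
    "LIM p (nhds a \<times>\<^sub>F nhds x). fst p *\<^sub>R snd p :> nhds (a *\<^sub>R x)"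

text \<open>
  A Frechet space is a locally convex space whose topology is induced by a complete
  translation-invariant metric. The class carries such a metric, but every notion defined
  below refers to the topology only; in particular, bounded sets are those of
  \<open>tvs_bounded\<close>, not the metrically bounded sets of the library.
\<close>

class frechet_space = real_tvs + complete_space +
  assumes dist_translate: "dist (x + z) (y + z) = dist x y"
    and locally_convex:
      "open N \<Longrightarrow> 0 \<in> N \<Longrightarrow> \<exists>C. open C \<and>
         (\<forall>x\<in>C. \<forall>y\<in>C. \<forall>u\<ge>0. \<forall>v\<ge>0. u + v = 1 \<longrightarrow> u *\<^sub>R x + v *\<^sub>R y \<in> C) \<and>
         0 \<in> C \<and> C \<subseteq> N"

lemma ex_open_convex_subset:
  fixes N :: "'a::frechet_space set"
  assumes "open N" "0 \<in> N"
  shows "\<exists>C. open C \<and> convex C \<and> 0 \<in> C \<and> C \<subseteq> N"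
  using locally_convex[OF assms] unfolding convex_def .

instance banach \<subseteq> frechet_space
proof
  fix a :: real and x :: 'a
  have "((\<lambda>p. fst p *\<^sub>R snd p) \<longlongrightarrow> a *\<^sub>R x) (nhds a \<times>\<^sub>F nhds x)"
    by (intro tendsto_scaleR filterlim_fst filterlim_snd)
  then show "LIM p (nhds a \<times>\<^sub>F nhds x). fst p *\<^sub>R snd p :> nhds (a *\<^sub>R x)" .
next
  fix x y z :: 'a
  show "dist (x + z) (y + z) = dist x y"
    by (simp add: dist_norm)
next
  fix N :: "'a set"
  assume "open N" "0 \<in> N"
  then obtain e where "e > 0" "ball 0 e \<subseteq> N"
    by (meson open_contains_ball)
  then have "\<exists>C. open C \<and> convex C \<and> 0 \<in> C \<and> C \<subseteq> N"
    by (intro exI[of _ "ball 0 e"]) auto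
  then show "\<exists>C. open C \<and>
      (\<forall>x\<in>C. \<forall>y\<in>C. \<forall>u\<ge>0. \<forall>v\<ge>0. u + v = 1 \<longrightarrow> u *\<^sub>R x + v *\<^sub>R y \<in> C) \<and>
      0 \<in> C \<and> C \<subseteq> N"
    unfolding convex_def .
qed

definition tvs_bounded :: "'a::real_tvs set \<Rightarrow> bool" where
  "tvs_bounded B \<longleftrightarrow>
     (\<forall>N. open N \<and> 0 \<in> N \<longrightarrow> (\<exists>s>0. \<forall>t>s. B \<subseteq> (\<lambda>x. t *\<^sub>R x) ` N))"


section \<open>Continuous linear maps with the topology of uniform convergence on bounded sets\<close>

definition cont_linear :: "('a::real_tvs \<Rightarrow> 'b::real_tvs) set" where
  "cont_linear = {A. linear A \<and> continuous_on UNIV A}"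

definition beta_nhd :: "'a::real_tvs set \<Rightarrow> 'b::real_tvs set \<Rightarrow> ('a \<Rightarrow> 'b) set" where
  "beta_nhd B N = {A \<in> cont_linear. A ` B \<subseteq> N}"

text \<open>
  The vector space topology on \<open>cont_linear\<close> for which the sets \<open>beta_nhd B N\<close>, with \<open>B\<close>
  bounded and \<open>N\<close> an open neighbourhood of \<open>0\<close>, form a basis of neighbourhoods of \<open>0\<close>:
  a set is open iff it contains, with each \<open>A\<close>, a translate \<open>A + beta_nhd B N\<close>.
\<close>

definition beta_open :: "('a::real_tvs \<Rightarrow> 'b::real_tvs) set \<Rightarrow> bool" where
  "beta_open S \<longleftrightarrow> S \<subseteq> cont_linear \<and>
     (\<forall>A\<in>S. \<exists>B N. tvs_bounded B \<and> open N \<and> 0 \<in> N \<and>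
        (\<forall>A'\<in>cont_linear. (\<lambda>v. A' v - A v) \<in> beta_nhd B N \<longrightarrow> A' \<in> S))"

definition beta_topology :: "('a::real_tvs \<Rightarrow> 'b::real_tvs) topology" where
  "beta_topology = topology beta_open"

lemma tvs_bounded_Un:
  assumes "tvs_bounded A" "tvs_bounded B"
  shows "tvs_bounded (A \<union> B)"
  unfolding tvs_bounded_def
proof (intro allI impI)
  fix N :: "'a set"
  assume N: "open N \<and> 0 \<in> N"
  obtain s where s: "s > 0" "\<forall>t>s. A \<subseteq> (\<lambda>x. t *\<^sub>R x) ` N"
    using assms(1) N unfolding tvs_bounded_def by blast
  obtain s' where s': "s' > 0" "\<forall>t>s'. B \<subseteq> (\<lambda>x. t *\<^sub>R x) ` N"
    using assms(2) N unfolding tvs_bounded_def by blast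
  show "\<exists>r>0. \<forall>t>r. A \<union> B \<subseteq> (\<lambda>x. t *\<^sub>R x) ` N"
    using s s' by (intro exI[of _ "max s s'"]) auto
qed

lemma istopology_beta_open: "istopology beta_open"
  unfolding istopology_def
proof (intro conjI allI impI)
  fix S T :: "('a \<Rightarrow> 'b) set"
  assume S: "beta_open S" and T: "beta_open T"
  show "beta_open (S \<inter> T)"
    unfolding beta_open_def
  proof (intro conjI ballI)
    show "S \<inter> T \<subseteq> cont_linear"
      using S unfolding beta_open_def by blast
  next
    fix A
    assume A: "A \<in> S \<inter> T"
    obtain B N where 1: "tvs_bounded B" "open N" "0 \<in> N"
      "\<forall>A'\<in>cont_linear. (\<lambda>v. A' v - A v) \<in> beta_nhd B N \<longrightarrow> A' \<in> S"
      using S A unfolding beta_open_def by blast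
    obtain B' N' where 2: "tvs_bounded B'" "open N'" "0 \<in> N'"
      "\<forall>A'\<in>cont_linear. (\<lambda>v. A' v - A v) \<in> beta_nhd B' N' \<longrightarrow> A' \<in> T"
      using T A unfolding beta_open_def by blast
    have "beta_nhd (B \<union> B') (N \<inter> N') \<subseteq> beta_nhd B N \<inter> beta_nhd B' N'"
      unfolding beta_nhd_def by auto
    then show "\<exists>B N. tvs_bounded B \<and> open N \<and> 0 \<in> N \<and>
        (\<forall>A'\<in>cont_linear. (\<lambda>v. A' v - A v) \<in> beta_nhd B N \<longrightarrow> A' \<in> S \<inter> T)"
      using 1 2 by (intro exI[of _ "B \<union> B'"] exI[of _ "N \<inter> N'"])
        (auto simp: tvs_bounded_Un)
  qed
next
  fix \<K> :: "('a \<Rightarrow> 'b) set set"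
  assume "\<forall>S\<in>\<K>. beta_open S"
  then show "beta_open (\<Union>\<K>)"
    unfolding beta_open_def by (simp add: Sup_le_iff) (meson UnionI)
qed

lemma openin_beta_topology: "openin beta_topology S \<longleftrightarrow> beta_open S"
  by (simp add: beta_topology_def istopology_beta_open topology_inverse')


section \<open>Maps of class $C^1_F$\<close>

definition has_dir_deriv ::
    "('a::real_tvs \<Rightarrow> 'b::real_tvs) \<Rightarrow> 'a \<Rightarrow> 'a \<Rightarrow> 'b \<Rightarrow> bool" where
  "has_dir_deriv f u v d \<longleftrightarrow>
     ((\<lambda>t::real. (1 / t) *\<^sub>R (f (u + t *\<^sub>R v) - f u)) \<longlongrightarrow> d) (at 0)"

definition DF :: "('a::real_tvs \<Rightarrow> 'b::real_tvs) \<Rightarrow> 'a \<Rightarrow> 'a \<Rightarrow> 'b" where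
  "DF f u v = Lim (at 0) (\<lambda>t::real. (1 / t) *\<^sub>R (f (u + t *\<^sub>R v) - f u))"

text \<open>
  Maps with an open domain \<open>U\<close> are total functions of which only the values on \<open>U\<close> matter.
\<close>

definition C1F_on :: "'a::real_tvs set \<Rightarrow> ('a \<Rightarrow> 'b::real_tvs) \<Rightarrow> bool" where
  "C1F_on U f \<longleftrightarrow> open U \<and> continuous_on U f \<and>
     (\<forall>u\<in>U. \<forall>v. \<exists>d. has_dir_deriv f u v d) \<and>
     (\<forall>u\<in>U. linear (DF f u) \<and> continuous_on UNIV (DF f u)) \<and>
     continuous_map (top_of_set U) beta_topology (DF f)"

definition C1F_diffeo ::
    "'a::frechet_space set \<Rightarrow> 'b::frechet_space set \<Rightarrow> ('a \<Rightarrow> 'b) \<Rightarrow> bool" where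
  "C1F_diffeo V W K \<longleftrightarrow> open V \<and> open W \<and> bij_betw K V W \<and>
     C1F_on V K \<and> C1F_on W (inv_into V K)"


section \<open>Submanifolds and tangent spaces\<close>

text \<open>The finiteness clause is needed since \<open>dim\<close> is \<open>0\<close> on infinite-dimensional spaces.\<close>

definition has_finite_dim :: "'a::real_vector set \<Rightarrow> nat \<Rightarrow> bool" where
  "has_finite_dim S m \<longleftrightarrow> (\<exists>B. finite B \<and> span B = S) \<and> dim S = m"

definition C1F_submanifold_over ::
    "'a::frechet_space set \<Rightarrow> 'a set \<Rightarrow> bool" where
  "C1F_submanifold_over G\<^sub>0 M \<longleftrightarrow>
     (\<forall>p\<in>M. \<exists>V W K. open V \<and> p \<in> V \<and> C1F_diffeo V W K \<and> K ` (M \<inter> V) = W \<inter> G\<^sub>0)"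

definition C1F_submanifold_codim :: "'a::frechet_space set \<Rightarrow> nat \<Rightarrow> bool" where
  "C1F_submanifold_codim M m \<longleftrightarrow>
     (\<exists>G\<^sub>0 H\<^sub>0. subspace G\<^sub>0 \<and> closed G\<^sub>0 \<and> subspace H\<^sub>0 \<and> closed H\<^sub>0 \<and>
        {a + b |a b. a \<in> G\<^sub>0 \<and> b \<in> H\<^sub>0} = UNIV \<and> G\<^sub>0 \<inter> H\<^sub>0 = {0} \<and>
        has_finite_dim H\<^sub>0 m \<and> C1F_submanifold_over G\<^sub>0 M)"

text \<open>
  Curves are differentiated through the directional derivative in direction \<open>1\<close>, since the
  library's vector derivative is confined to normed spaces.
\<close>

definition tangent_space :: "'a::frechet_space set \<Rightarrow> 'a \<Rightarrow> 'a set" where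
  "tangent_space M p =
     {w. \<exists>I (c :: real \<Rightarrow> 'a) c'. open I \<and> is_interval I \<and> 0 \<in> I \<and>
           (\<forall>t\<in>I. has_dir_deriv c t 1 (c' t)) \<and> continuous_on I c' \<and>
           c 0 = p \<and> c ` I \<subseteq> M \<and> c' 0 = w}"

end

theory Submission
  imports Defs
begin

text \<open>
  Let \<open>K\<close> be a submanifold chart of \<open>M\<close> at \<open>g x\<close>, and let \<open>\<beta>\<^sub>1, \<dots>, \<beta>\<^sub>m\<close> be continuous linear
  functionals with common kernel \<open>G\<^sub>0\<close>, dual to a basis of the finite-dimensional complement \<open>H\<^sub>0\<close>.
  Near \<open>x\<close> the preimage of \<open>M\<close> is the common zero set of the scalar functions
  \<open>\<phi>\<^sub>i = \<beta>\<^sub>i \<circ> K \<circ> g\<close>, and transversality provides vectors \<open>e\<^sub>j\<close> with \<open>D\<phi>\<^sub>i(x) e\<^sub>j = \<delta>\<^sub>i\<^sub>j\<close>.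
  No inverse function theorem in Frechet spaces is needed: the \<open>\<phi>\<^sub>i\<close> are straightened one after
  the other by maps \<open>y \<mapsto> y + s(y) e\<^sub>i\<close> with \<open>s\<close> scalar and \<open>Ds(y\<^sub>0) = 0\<close>. Inverting such a map means
  solving the scalar equation \<open>\<tau> = -s(w + \<tau> e\<^sub>i)\<close>, which the intermediate value theorem does, and
  \<open>D\<tau>(w)v = -Ds(y)v / (1 + Ds(y)e\<^sub>i)\<close>, \<open>y = w + \<tau>(w) e\<^sub>i\<close>, is continuous in \<open>w\<close> for the topology \<open>\<beta>\<close>.
  In a chart, the tangent space is the preimage of the model space under the derivative of the
  chart, which gives the formula for the tangent space of the preimage.
\<close>


section \<open>Bounded sets and the topology of uniform convergence on bounded sets\<close>

lemma tendsto_scaleR_tvs: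
  fixes g :: "'b \<Rightarrow> 'a::real_tvs"
  assumes "(f \<longlongrightarrow> a) F" "(g \<longlongrightarrow> x) F"
  shows "((\<lambda>t. f t *\<^sub>R g t) \<longlongrightarrow> a *\<^sub>R x) F"
  using filterlim_compose[OF tendsto_scaleR_Pair filterlim_Pair[OF assms]] by simp

text \<open>The substitution \<open>r = 1 / t\<close> turns absorption by all large dilations into a
  statement about all \<open>r\<close> near \<open>0\<close>, a form that composes directly with
  limits.\<close>

lemma tvs_bounded_iff_eventually:
  fixes B :: "'a::real_tvs set"
  shows "tvs_bounded B \<longleftrightarrow>
    (\<forall>N. open N \<and> 0 \<in> N \<longrightarrow> (\<forall>\<^sub>F r in nhds 0. \<forall>b\<in>B. r *\<^sub>R b \<in> N))"
proof (intro iffI allI impI)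
  fix N :: "'a set"
  assume B: "tvs_bounded B" and N: "open N \<and> 0 \<in> N"
  \<comment> \<open>The dilation factors in \<open>tvs_bounded\<close> are positive; intersecting
    \<open>N\<close> with its reflection takes care of negative \<open>r\<close>.\<close>
  have "open (N \<inter> uminus -` N)"
    using N by (intro open_Int open_vimage) (auto intro!: continuous_intros)
  then obtain s where s: "s > 0" "\<And>t. t > s \<Longrightarrow> B \<subseteq> (\<lambda>x. t *\<^sub>R x) ` (N \<inter> uminus -` N)"
    using B[unfolded tvs_bounded_def, rule_format, of "N \<inter> uminus -` N"] N by auto
  have "r *\<^sub>R b \<in> N" if r: "dist r 0 < 1 / s" and b: "b \<in> B" for r b
  proof (cases "r = 0")
    case False
    have "1 / \<bar>r\<bar> > s"
      using False r s(1) by (simp add: field_simps)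
    then have "b \<in> (\<lambda>x. (1 / \<bar>r\<bar>) *\<^sub>R x) ` (N \<inter> uminus -` N)"
      using s(2) b by blast
    then obtain n where n: "b = (1 / \<bar>r\<bar>) *\<^sub>R n" "n \<in> N" "- n \<in> N"
      by blast
    have "r *\<^sub>R b = n \<or> r *\<^sub>R b = - n"
    proof -
      have "r * (1 / \<bar>r\<bar>) = 1 \<or> r * (1 / \<bar>r\<bar>) = - 1"
        using False by (auto simp: abs_if)
      then show ?thesis
        unfolding n(1) scaleR_scaleR by (metis scaleR_one scaleR_minus1_left)
    qed
    then show ?thesis using n by metis
  qed (use N in simp)
  then show "\<forall>\<^sub>F r in nhds 0. \<forall>b\<in>B. r *\<^sub>R b \<in> N"
    unfolding eventually_nhds_metric using s(1) by (intro exI[of _ "1 / s"]) auto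
next
  assume *: "\<forall>N. open N \<and> 0 \<in> N \<longrightarrow> (\<forall>\<^sub>F r in nhds 0. \<forall>b\<in>B. r *\<^sub>R b \<in> N)"
  show "tvs_bounded B"
    unfolding tvs_bounded_def
  proof (intro allI impI)
    fix N :: "'a set"
    assume "open N \<and> 0 \<in> N"
    then have "\<forall>\<^sub>F r in nhds 0. \<forall>b\<in>B. r *\<^sub>R b \<in> N"
      using * by simp
    then obtain d where d: "d > 0" "\<And>r b. dist r 0 < d \<Longrightarrow> b \<in> B \<Longrightarrow> r *\<^sub>R b \<in> N"
      unfolding eventually_nhds_metric by auto
    have "B \<subseteq> (\<lambda>x. t *\<^sub>R x) ` N" if t: "t > 1 / d" for t
    proof
      fix b assume b: "b \<in> B"
      have t0: "t > 0" using t d(1) less_trans[of 0 "1 / d" t] by simp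
      then have "dist (1 / t) 0 < d"
        using t d(1) by (simp add: field_simps)
      then have "(1 / t) *\<^sub>R b \<in> N" using d(2) b by blast
      then show "b \<in> (\<lambda>x. t *\<^sub>R x) ` N"
        using t0 by (intro image_eqI[of _ _ "(1 / t) *\<^sub>R b"]) auto
    qed
    then show "\<exists>s>0. \<forall>t>s. B \<subseteq> (\<lambda>x. t *\<^sub>R x) ` N"
      using d(1) by (intro exI[of _ "1 / d"]) auto
  qed
qed

lemma tvs_bounded_image:
  assumes "A \<in> cont_linear" "tvs_bounded B"
  shows "tvs_bounded (A ` B)"
  unfolding tvs_bounded_iff_eventually
proof (intro allI impI)
  fix N :: "'b set"
  assume N: "open N \<and> 0 \<in> N"
  have A: "linear A" "continuous_on UNIV A"
    using assms(1) unfolding cont_linear_def by auto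
  have "open (A -` N)" "0 \<in> A -` N"
    using N A by (auto intro: open_vimage simp: linear_0)
  then have "\<forall>\<^sub>F r in nhds 0. \<forall>b\<in>B. r *\<^sub>R b \<in> A -` N"
    using assms(2) unfolding tvs_bounded_iff_eventually by blast
  then show "\<forall>\<^sub>F r in nhds 0. \<forall>b\<in>A ` B. r *\<^sub>R b \<in> N"
    using A(1) by (simp add: linear_scale)
qed

lemma tvs_bounded_mult_null:
  fixes v :: "nat \<Rightarrow> 'a::real_tvs"
  assumes "tvs_bounded (range v)" "r \<longlonglongrightarrow> 0"
  shows "(\<lambda>n. r n *\<^sub>R v n) \<longlonglongrightarrow> 0"
proof (rule topological_tendstoI)
  fix N :: "'a set"
  assume "open N" "0 \<in> N"
  then have "\<forall>\<^sub>F r in nhds 0. \<forall>b\<in>range v. r *\<^sub>R b \<in> N"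
    using assms(1) unfolding tvs_bounded_iff_eventually by blast
  then have "\<forall>\<^sub>F n in sequentially. \<forall>b\<in>range v. r n *\<^sub>R b \<in> N"
    using assms(2) by (rule eventually_compose_filterlim)
  then show "\<forall>\<^sub>F n in sequentially. r n *\<^sub>R v n \<in> N"
    by eventually_elim auto
qed

text \<open>Joint continuity of scaling at \<open>(0, l)\<close> provides one neighbourhood of
  \<open>0\<close> in the scalars that works for all late terms; the finitely many early terms are
  absorbed individually.\<close>

lemma tvs_bounded_convergent_seq:
  fixes v :: "nat \<Rightarrow> 'a::real_tvs"
  assumes "v \<longlonglongrightarrow> l"
  shows "tvs_bounded (range v)"
  unfolding tvs_bounded_iff_eventually
proof (intro allI impI)
  fix N :: "'a set"
  assume N: "open N \<and> 0 \<in> N"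
  have "((\<lambda>p. fst p *\<^sub>R v (snd p)) \<longlongrightarrow> 0 *\<^sub>R l) (nhds 0 \<times>\<^sub>F sequentially)"
    by (intro tendsto_scaleR_tvs filterlim_fst filterlim_compose[OF assms] filterlim_snd)
  then have "\<forall>\<^sub>F p in nhds 0 \<times>\<^sub>F sequentially. fst p *\<^sub>R v (snd p) \<in> N"
    using N by (auto dest: topological_tendstoD)
  then obtain P Q where PQ: "eventually P (nhds 0)" "eventually Q sequentially"
      "\<And>r n. P r \<Longrightarrow> Q n \<Longrightarrow> r *\<^sub>R v n \<in> N"
    unfolding eventually_prod_filter by force
  obtain n0 where n0: "\<And>n. n \<ge> n0 \<Longrightarrow> Q n"
    using PQ(2) unfolding eventually_sequentially by blast
  have "\<forall>\<^sub>F r in nhds 0. r *\<^sub>R v n \<in> N" for n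
  proof -
    have "((\<lambda>r. r *\<^sub>R v n) \<longlongrightarrow> 0 *\<^sub>R v n) (nhds 0)"
      by (intro tendsto_scaleR_tvs filterlim_ident tendsto_const)
    then show ?thesis using N by (auto dest: topological_tendstoD)
  qed
  then have "\<forall>\<^sub>F r in nhds 0. \<forall>n\<in>{..<n0}. r *\<^sub>R v n \<in> N"
    by (intro eventually_ball_finite) auto
  with PQ(1) show "\<forall>\<^sub>F r in nhds 0. \<forall>b\<in>range v. r *\<^sub>R b \<in> N"
  proof eventually_elim
    case (elim r)
    then show ?case using PQ(3) n0 by (metis imageE lessThan_iff not_less)
  qed
qed

section \<open>Metric and sequential descriptions of the topology \<beta>\<close>

lemma dist_diff_0:
  fixes x y :: "'a::frechet_space"
  shows "dist (x - y) 0 = dist x y"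
  using dist_translate[of "x - y" y 0] by simp

text \<open>Balls about \<open>0\<close> form a neighbourhood base in the target and, by translation
  invariance of \<open>dist\<close>, measure differences. Continuity for \<beta> thus becomes
  uniform convergence of \<open>D u'\<close> to \<open>D u\<close> on each bounded set.\<close>

lemma continuous_map_beta_iff:
  fixes D :: "'a::frechet_space \<Rightarrow> 'b::frechet_space \<Rightarrow> 'c::frechet_space"
  shows "continuous_map (top_of_set U) beta_topology D \<longleftrightarrow>
    (\<forall>u\<in>U. D u \<in> cont_linear) \<and>
    (\<forall>u\<in>U. \<forall>B. tvs_bounded B \<longrightarrow> (\<forall>e>0. \<exists>d>0. \<forall>u'\<in>U. dist u' u < d \<longrightarrow>
       (\<forall>v\<in>B. dist (D u' v) (D u v) < e)))" (is "?L \<longleftrightarrow> ?R1 \<and> ?R2")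
proof
  have top: "topspace (beta_topology :: ('b \<Rightarrow> 'c) topology) = cont_linear"
  proof (rule antisym)
    show "topspace (beta_topology :: ('b \<Rightarrow> 'c) topology) \<subseteq> cont_linear"
      using openin_topspace[of "beta_topology :: ('b \<Rightarrow> 'c) topology"]
      unfolding openin_beta_topology beta_open_def by blast
    \<comment> \<open>The witness \<open>B = {}\<close>, \<open>N = UNIV\<close> shows that
      \<open>cont_linear\<close> is \<beta>-open, so it is the whole space of the topology.\<close>
    have "tvs_bounded ({} :: 'b set)"
      unfolding tvs_bounded_def using zero_less_one by blast
    then have "beta_open (cont_linear :: ('b \<Rightarrow> 'c) set)"
      unfolding beta_open_def using open_UNIV by blast
    then show "cont_linear \<subseteq> topspace (beta_topology :: ('b \<Rightarrow> 'c) topology)"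
      by (simp add: openin_beta_topology openin_subset)
  qed
  {
    assume L: ?L
    have R1: ?R1
      using continuous_map_image_subset_topspace[OF L] unfolding top by auto
    have ?R2
    proof (intro ballI allI impI)
      fix u and B :: "'b set" and e :: real
      assume u: "u \<in> U" and B: "tvs_bounded B" and e: "e > 0"
      \<comment> \<open>A bound by some \<open>q < e\<close>, uniform on \<open>B\<close>, makes \<open>S\<close> open; with the pointwise bound
        \<open>< e\<close> this could fail.\<close>
      define S where "S = {A \<in> cont_linear. \<exists>q<e. \<forall>v\<in>B. dist (A v) (D u v) \<le> q}"
      have "beta_open S"
        unfolding beta_open_def
      proof (intro conjI ballI)
        show "S \<subseteq> cont_linear" unfolding S_def by blast
        fix A assume "A \<in> S"
        then obtain q where q: "q < e" "\<And>v. v \<in> B \<Longrightarrow> dist (A v) (D u v) \<le> q"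
          unfolding S_def by blast
        have "A' \<in> S" if A': "A' \<in> cont_linear" "(\<lambda>v. A' v - A v) \<in> beta_nhd B (ball 0 ((e - q) / 2))" for A'
        proof -
          have "dist (A' v) (D u v) \<le> (e + q) / 2" if v: "v \<in> B" for v
          proof -
            have "A' v - A v \<in> ball 0 ((e - q) / 2)"
              using A'(2) v unfolding beta_nhd_def by blast
            then have "dist (A' v) (A v) < (e - q) / 2"
              by (metis dist_commute dist_diff_0 mem_ball)
            then show ?thesis
              using q(2)[OF v] dist_triangle[of "A' v" "D u v" "A v"] by (simp add: field_simps)
          qed
          moreover have "(e + q) / 2 < e" using q(1) by simp
          ultimately show ?thesis using A'(1) unfolding S_def by blast
        qed
        then show "\<exists>B N. tvs_bounded B \<and> open N \<and> 0 \<in> N \<and>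
            (\<forall>A'\<in>cont_linear. (\<lambda>v. A' v - A v) \<in> beta_nhd B N \<longrightarrow> A' \<in> S)"
          using B q(1) by (intro exI[of _ B] exI[of _ "ball 0 ((e - q) / 2)"]) auto
      qed
      then have "openin (top_of_set U) {x \<in> U. D x \<in> S}"
        using L unfolding continuous_map_def openin_beta_topology by auto
      moreover have "D u \<in> S"
        using R1 u e unfolding S_def by auto
      ultimately obtain d where "d > 0" "\<And>u'. u' \<in> U \<Longrightarrow> dist u' u < d \<Longrightarrow> D u' \<in> S"
        using u unfolding openin_euclidean_subtopology_iff by blast
      then show "\<exists>d>0. \<forall>u'\<in>U. dist u' u < d \<longrightarrow> (\<forall>v\<in>B. dist (D u' v) (D u v) < e)"
        unfolding S_def by fastforce
    qed
    with R1 show "?R1 \<and> ?R2" by blast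
  next
    assume R: "?R1 \<and> ?R2"
    have "openin (top_of_set U) {x \<in> U. D x \<in> S}" if S: "beta_open S" for S
      unfolding openin_euclidean_subtopology_iff
    proof (intro conjI ballI)
      fix u assume u: "u \<in> {x \<in> U. D x \<in> S}"
      then obtain B N where BN: "tvs_bounded B" "open N" "0 \<in> N"
        "\<And>A'. A' \<in> cont_linear \<Longrightarrow> (\<lambda>v. A' v - D u v) \<in> beta_nhd B N \<Longrightarrow> A' \<in> S"
        using S unfolding beta_open_def by blast
      obtain e where e: "e > 0" "\<And>y. dist y 0 < e \<Longrightarrow> y \<in> N"
        using BN(2,3) unfolding open_dist by blast
      obtain d where d: "d > 0"
        "\<And>u' v. u' \<in> U \<Longrightarrow> dist u' u < d \<Longrightarrow> v \<in> B \<Longrightarrow> dist (D u' v) (D u v) < e"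
        using conjunct2[OF R, rule_format, OF _ BN(1) e(1), of u] u by blast
      have "D u' \<in> S" if u': "u' \<in> U" "dist u' u < d" for u'
      proof (rule BN(4))
        have cl: "D u' \<in> cont_linear" "D u \<in> cont_linear" using R u u' by auto
        then show "D u' \<in> cont_linear" by blast
        have "(\<lambda>v. D u' v - D u v) \<in> cont_linear"
          using cl unfolding cont_linear_def
          by (auto intro!: linear_compose_sub continuous_on_diff)
        then show "(\<lambda>v. D u' v - D u v) \<in> beta_nhd B N"
          using d(2)[OF u'] e(2) unfolding beta_nhd_def by (auto simp: dist_diff_0)
      qed
      then show "\<exists>e>0. \<forall>x'\<in>U. dist x' u < e \<longrightarrow> x' \<in> {x \<in> U. D x \<in> S}"
        using d(1) by blast
    qed auto
    then show ?L
      using R unfolding continuous_map_def openin_beta_topology top by auto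
  }
qed

text \<open>
  The last clause expresses continuity of the derivative with respect to \<open>\<beta>\<close> by sequences, which
  suffices since the domain is metrizable. Composition of continuous linear maps is not jointly
  continuous for \<open>\<beta>\<close>, but it is sequentially so, which is what the chain rule requires.
\<close>

definition has_C1F_deriv ::
    "'a::frechet_space set \<Rightarrow> ('a \<Rightarrow> 'b::frechet_space) \<Rightarrow> ('a \<Rightarrow> 'a \<Rightarrow> 'b) \<Rightarrow> bool" where
  "has_C1F_deriv U f f' \<longleftrightarrow> open U \<and> continuous_on U f \<and>
     (\<forall>u\<in>U. f' u \<in> cont_linear) \<and> (\<forall>u\<in>U. \<forall>v. has_dir_deriv f u v (f' u v)) \<and>
     (\<forall>X u v. range X \<subseteq> U \<and> u \<in> U \<and> X \<longlonglongrightarrow> u \<and> tvs_bounded (range v) \<longrightarrow>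
        (\<lambda>n. f' (X n) (v n) - f' u (v n)) \<longlonglongrightarrow> 0)"

section \<open>Equivalence of the sequential notion with \<open>C1F_on\<close>\<close>

lemma DF_eq:
  assumes "has_dir_deriv f u v d"
  shows "DF f u v = d"
  using assms unfolding has_dir_deriv_def DF_def by (intro tendsto_Lim) auto

lemma has_dir_deriv_unique:
  assumes "has_dir_deriv f u v d" "has_dir_deriv f u v d'"
  shows "d = d'"
  using DF_eq assms by metis

lemma has_C1F_deriv_eq_DF:
  assumes "has_C1F_deriv U f f'" "u \<in> U"
  shows "DF f u = f' u"
  using assms unfolding has_C1F_deriv_def by (intro ext DF_eq) blast

lemma tendsto_diff_0_iff_dist:
  fixes f g :: "'b \<Rightarrow> 'a::frechet_space"
  shows "((\<lambda>n. f n - g n) \<longlongrightarrow> 0) F \<longleftrightarrow> ((\<lambda>n. dist (f n) (g n)) \<longlongrightarrow> 0) F"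
  unfolding tendsto_dist_iff[of "\<lambda>n. f n - g n"] dist_diff_0 ..

text \<open>If uniformity failed on a bounded \<open>B\<close>, there would be points
  \<open>X n\<close> tending to \<open>u\<close> and vectors \<open>v n\<close> in \<open>B\<close>
  at which the derivatives stay \<open>e\<close> apart. As a subset of \<open>B\<close> the range of
  \<open>v\<close> is bounded, so the sequential clause is contradicted.\<close>

lemma has_C1F_deriv_imp_C1F_on:
  fixes f :: "'a::frechet_space \<Rightarrow> 'b::frechet_space"
  assumes f: "has_C1F_deriv U f f'"
  shows "C1F_on U f"
proof -
  have cl: "f' u \<in> cont_linear" if "u \<in> U" for u
    using f that unfolding has_C1F_deriv_def by blast
  have "\<exists>d>0. \<forall>u'\<in>U. dist u' u < d \<longrightarrow> (\<forall>v\<in>B. dist (f' u' v) (f' u v) < e)"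
    if u: "u \<in> U" and B: "tvs_bounded B" and e: "e > 0" for u B e
  proof (rule ccontr)
    assume neg: "\<not> ?thesis"
    have "\<exists>x w. x \<in> U \<and> dist x u < inverse (Suc n) \<and> w \<in> B \<and> \<not> dist (f' x w) (f' u w) < e" for n
      using neg by (metis inverse_positive_iff_positive of_nat_0_less_iff zero_less_Suc)
    then obtain X v where Xv: "\<And>n. X n \<in> U" "\<And>n. dist (X n) u < inverse (Suc n)" "\<And>n. v n \<in> B"
        "\<And>n. \<not> dist (f' (X n) (v n)) (f' u (v n)) < e"
      by metis
    have "X \<longlonglongrightarrow> u"
      unfolding tendsto_dist_iff[of X]
      by (rule real_tendsto_sandwich[OF _ _ tendsto_const LIMSEQ_inverse_real_of_nat])
        (use Xv(2) in \<open>auto intro!: always_eventually less_imp_le\<close>)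
    moreover have "tvs_bounded (range v)"
      using B Xv(3) unfolding tvs_bounded_iff_eventually
      by (smt (verit, best) eventually_mono imageE)
    ultimately have "(\<lambda>n. f' (X n) (v n) - f' u (v n)) \<longlonglongrightarrow> 0"
      using f u Xv(1) unfolding has_C1F_deriv_def by blast
    then have "\<forall>\<^sub>F n in sequentially. dist (f' (X n) (v n)) (f' u (v n)) < e"
      unfolding tendsto_diff_0_iff_dist using e by (rule order_tendstoD)
    then show False
      using Xv(4) by simp
  qed
  then have "continuous_map (top_of_set U) beta_topology f'"
    unfolding continuous_map_beta_iff using cl by blast
  then have "continuous_map (top_of_set U) beta_topology (DF f)"
    by (rule continuous_map_eq) (use has_C1F_deriv_eq_DF[OF f] in auto)
  moreover have "linear (DF f u) \<and> continuous_on UNIV (DF f u)" if "u \<in> U" for u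
    using has_C1F_deriv_eq_DF[OF f that] cl[OF that] unfolding cont_linear_def by auto
  ultimately show ?thesis
    using f unfolding C1F_on_def has_C1F_deriv_def by blast
qed

text \<open>The range of a bounded sequence \<open>v\<close> is itself an admissible bounded set for
  \<beta>, and uniform convergence on it covers the arguments \<open>v n\<close> that vary with
  \<open>n\<close>.\<close>

lemma C1F_on_imp_has_C1F_deriv:
  fixes f :: "'a::frechet_space \<Rightarrow> 'b::frechet_space"
  assumes f: "C1F_on U f"
  shows "has_C1F_deriv U f (DF f)"
  unfolding has_C1F_deriv_def
proof (intro conjI ballI allI impI)
  show "open U" "continuous_on U f" using f unfolding C1F_on_def by auto
  fix u v assume u: "u \<in> U"
  show "DF f u \<in> cont_linear"
    using f u unfolding C1F_on_def cont_linear_def by blast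
  show "has_dir_deriv f u v (DF f u v)"
    using f u DF_eq unfolding C1F_on_def by metis
next
  have cm: "continuous_map (top_of_set U) beta_topology (DF f)"
    using f unfolding C1F_on_def by blast
  fix X u and v :: "nat \<Rightarrow> 'a"
  assume "range X \<subseteq> U \<and> u \<in> U \<and> X \<longlonglongrightarrow> u \<and> tvs_bounded (range v)"
  then have X: "\<And>n. X n \<in> U" "u \<in> U" "X \<longlonglongrightarrow> u" and v: "tvs_bounded (range v)" by auto
  have "\<forall>\<^sub>F n in sequentially. dist (DF f (X n) (v n)) (DF f u (v n)) < e" if e: "e > 0" for e
  proof -
    obtain d where d: "d > 0" "\<And>u' w. u' \<in> U \<Longrightarrow> dist u' u < d \<Longrightarrow> w \<in> range v \<Longrightarrow>
        dist (DF f u' w) (DF f u w) < e"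
      using cm v X(2) e unfolding continuous_map_beta_iff by metis
    have "\<forall>\<^sub>F n in sequentially. dist (X n) u < d"
      using X(3) d(1) by (rule tendstoD)
    then show ?thesis
      by eventually_elim (use X(1) d(2) in auto)
  qed
  then show "(\<lambda>n. DF f (X n) (v n) - DF f u (v n)) \<longlonglongrightarrow> 0"
    unfolding tendsto_iff by (simp add: dist_diff_0)
qed


section \<open>Mean value theorem and chain rule\<close>

lemma continuous_on_scaleR_tvs:
  fixes g :: "'b::topological_space \<Rightarrow> 'a::real_tvs"
  assumes "continuous_on S f" "continuous_on S g"
  shows "continuous_on S (\<lambda>x. f x *\<^sub>R g x)"
  using assms unfolding continuous_on_def by (auto intro!: tendsto_scaleR_tvs)

lemma ex_open_convex_nhd:
  fixes z :: "'a::frechet_space"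
  assumes "open N" "z \<in> N"
  obtains C where "open C" "convex C" "z \<in> C" "C \<subseteq> N"
proof -
  have "open ((\<lambda>y. y + z) -` N)" "0 \<in> (\<lambda>y. y + z) -` N"
    using assms by (auto intro!: open_vimage continuous_intros)
  then obtain C where C: "open C" "convex C" "0 \<in> C" "C \<subseteq> (\<lambda>y. y + z) -` N"
    using ex_open_convex_subset by blast
  show ?thesis
  proof
    show "open ((\<lambda>y. y - z) -` C)"
      using C(1) by (auto intro!: open_vimage continuous_intros)
    have "(\<lambda>y. y - z) -` C = (\<lambda>y. z + y) ` C"
      by (force simp: image_iff)
    then show "convex ((\<lambda>y. y - z) -` C)"
      using C(2) by (simp add: convex_translation)
    show "z \<in> (\<lambda>y. y - z) -` C" using C(3) by simp
    show "(\<lambda>y. y - z) -` C \<subseteq> N"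
      using C(4) by force
  qed
qed

lemma difference_quotient_convex_comb:
  fixes c :: "real \<Rightarrow> 'a::real_vector"
  assumes "a < x" "x < b"
  shows "(1 / (b - a)) *\<^sub>R (c b - c a) =
    ((x - a) / (b - a)) *\<^sub>R ((1 / (x - a)) *\<^sub>R (c x - c a)) +
    ((b - x) / (b - a)) *\<^sub>R ((1 / (b - x)) *\<^sub>R (c b - c x))"
proof -
  have "(x - a) / (b - a) * (1 / (x - a)) = 1 / (b - a)" "(b - x) / (b - a) * (1 / (b - x)) = 1 / (b - a)"
    using assms by simp_all
  then have "((x - a) / (b - a)) *\<^sub>R ((1 / (x - a)) *\<^sub>R (c x - c a)) +
    ((b - x) / (b - a)) *\<^sub>R ((1 / (b - x)) *\<^sub>R (c b - c x)) =
    (1 / (b - a)) *\<^sub>R (c x - c a) + (1 / (b - a)) *\<^sub>R (c b - c x)"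
    by (simp only: scaleR_scaleR)
  also have "\<dots> = (1 / (b - a)) *\<^sub>R (c b - c a)"
    unfolding scaleR_add_right[symmetric] by simp
  finally show ?thesis ..
qed

lemma difference_quotient_swap:
  fixes y z :: "'a::real_vector" and p x :: real
  shows "(1 / (p - x)) *\<^sub>R (y - z) = (1 / (x - p)) *\<^sub>R (z - y)"
proof -
  have "1 / (p - x) = - (1 / (x - p))"
    by (simp add: minus_divide_right)
  then show ?thesis
    by (simp only: scaleR_minus_left scaleR_minus_right[symmetric] minus_diff_eq)
qed

text \<open>
  The bisection argument replaces the usual appeal to the Hahn-Banach theorem: a difference
  quotient is a convex combination of the quotients over the two halves.
\<close>

lemma mean_value_convex:
  fixes c :: "real \<Rightarrow> 'a::real_tvs"
  assumes "a < b" and C: "open C" "convex C"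
    and deriv: "\<And>t. a \<le> t \<Longrightarrow> t \<le> b \<Longrightarrow> has_dir_deriv c t 1 (c' t) \<and> c' t \<in> C"
  shows "(1 / (b - a)) *\<^sub>R (c b - c a) \<in> C"
proof -
  have comb: "(1 / (q - p)) *\<^sub>R (c q - c p) \<in> C"
    if "p < x" "x < q" "(1 / (x - p)) *\<^sub>R (c x - c p) \<in> C" "(1 / (q - x)) *\<^sub>R (c q - c x) \<in> C"
    for p x q
    unfolding difference_quotient_convex_comb[OF that(1,2)]
    by (rule convexD[OF C(2) that(3,4)])
      (use that(1,2) in \<open>auto simp: add_divide_distrib[symmetric]\<close>)
  \<comment> \<open>\<open>P\<close> passes from two adjacent intervals to their union and holds on
    all short intervals around a given point, which is what the \<open>Bolzano\<close> rule
    requires. The guard \<open>p < q\<close> makes degenerate intervals harmless.\<close>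
  define P where "P = (\<lambda>p q. p < q \<longrightarrow> (1 / (q - p)) *\<^sub>R (c q - c p) \<in> C)"
  have "P a b"
    using less_imp_le[OF assms(1)]
  proof (rule Bolzano[of a b P])
    fix p q r
    assume "P p q" "P q r" "p \<le> q" "q \<le> r"
    then show "P p r"
      using comb[of p q r] unfolding P_def by (cases "p = q"; cases "q = r") auto
  next
    fix x assume local: "a \<le> x" "x \<le> b"
    have "((\<lambda>t. (1 / t) *\<^sub>R (c (x + t) - c x)) \<longlongrightarrow> c' x) (at 0)"
      using deriv[OF local] unfolding has_dir_deriv_def by simp
    then have "\<forall>\<^sub>F t in at 0. (1 / t) *\<^sub>R (c (x + t) - c x) \<in> C"
      using C(1) deriv[OF local] by (auto dest: topological_tendstoD)
    then obtain d where d: "d > 0" "\<And>t. t \<noteq> 0 \<Longrightarrow> dist t 0 < d \<Longrightarrow> (1 / t) *\<^sub>R (c (x + t) - c x) \<in> C"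
      unfolding eventually_at by auto
    have r: "(1 / (q - x)) *\<^sub>R (c q - c x) \<in> C" if "x < q" "q - x < d" for q
      using d(2)[of "q - x"] that by simp
    have l: "(1 / (x - p)) *\<^sub>R (c x - c p) \<in> C" if "p < x" "x - p < d" for p
    proof -
      have "(1 / (p - x)) *\<^sub>R (c p - c x) \<in> C"
        using d(2)[of "p - x"] that by simp
      moreover have "(1 / (p - x)) *\<^sub>R (c p - c x) = (1 / (x - p)) *\<^sub>R (c x - c p)"
        by (rule difference_quotient_swap)
      ultimately show ?thesis by simp
    qed
    have "P p q" if "p \<le> x" "x \<le> q" "q - p < d" for p q
      using that comb[of p x q] l[of p] r[of q] unfolding P_def
      by (cases "p = x"; cases "q = x") auto
    with d(1) show "\<exists>d>0. \<forall>p q. p \<le> x \<and> x \<le> q \<and> q - p < d \<longrightarrow> P p q"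
      by blast
  qed
  then show ?thesis using assms(1) unfolding P_def by blast
qed

lemma has_C1F_derivD:
  assumes "has_C1F_deriv U f f'"
  shows "open U" "continuous_on U f" "u \<in> U \<Longrightarrow> f' u \<in> cont_linear"
    "u \<in> U \<Longrightarrow> linear (f' u)" "u \<in> U \<Longrightarrow> continuous_on UNIV (f' u)"
    "u \<in> U \<Longrightarrow> has_dir_deriv f u v (f' u v)"
    "(\<And>n. X n \<in> U) \<Longrightarrow> u \<in> U \<Longrightarrow> X \<longlonglongrightarrow> u \<Longrightarrow> tvs_bounded (range w) \<Longrightarrow>
       (\<lambda>n. f' (X n) (w n) - f' u (w n)) \<longlonglongrightarrow> 0"
  using assms unfolding has_C1F_deriv_def cont_linear_def by (auto simp: image_subset_iff)

lemma cont_linear_tendsto: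
  assumes "A \<in> cont_linear" "(f \<longlongrightarrow> l) F"
  shows "((\<lambda>x. A (f x)) \<longlongrightarrow> A l) F"
  using assms unfolding cont_linear_def by (auto intro: continuous_on_tendsto_compose)

text \<open>Subtract and add \<open>f' u (v n)\<close>: a convergent sequence is bounded, so the
  difference tends to \<open>0\<close> by the \<beta>-clause, and the remaining term converges by
  continuity of \<open>f' u\<close>.\<close>

lemma has_C1F_deriv_joint_seq:
  assumes f: "has_C1F_deriv U f f'" and X: "\<And>n. X n \<in> U" "u \<in> U" "X \<longlonglongrightarrow> u" and v: "v \<longlonglongrightarrow> w"
  shows "(\<lambda>n. f' (X n) (v n)) \<longlonglongrightarrow> f' u w"
proof -
  have "(\<lambda>n. (f' (X n) (v n) - f' u (v n)) + f' u (v n)) \<longlonglongrightarrow> 0 + f' u w"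
    by (rule tendsto_add[OF has_C1F_derivD(7)[OF f X tvs_bounded_convergent_seq[OF v]]
          cont_linear_tendsto[OF has_C1F_derivD(3)[OF f X(2)] v]])
  then show ?thesis by simp
qed

lemma has_C1F_deriv_joint_continuous:
  assumes "has_C1F_deriv U f f'"
  shows "continuous_on (U \<times> UNIV) (\<lambda>p. f' (fst p) (snd p))"
  unfolding continuous_on_sequentially comp_def
proof (intro allI ballI impI)
  fix x a assume "a \<in> U \<times> (UNIV :: 'a set)" "(\<forall>n. x n \<in> U \<times> UNIV) \<and> x \<longlonglongrightarrow> a"
  then show "(\<lambda>n. f' (fst (x n)) (snd (x n))) \<longlonglongrightarrow> f' (fst a) (snd a)"
    by (intro has_C1F_deriv_joint_seq[OF assms] tendsto_fst tendsto_snd) (auto simp: mem_Times_iff)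
qed

section \<open>Difference quotients with varying direction and the chain rule\<close>

lemma has_dir_deriv_along_line:
  assumes "has_dir_deriv f (u + r *\<^sub>R v) v d"
  shows "has_dir_deriv (\<lambda>t. f (u + t *\<^sub>R v)) r 1 d"
  using assms unfolding has_dir_deriv_def by (simp add: scaleR_add_left add.assoc)

text \<open>The direction may vary with \<open>t\<close>, as in Hadamard differentiability; the
  chain rule needs this. By joint continuity all values \<open>f' (u + r v) v\<close> with
  \<open>r\<close> small and \<open>v\<close> near \<open>w0\<close> lie in a convex neighbourhood
  of the limit, and the mean value theorem carries this over to the difference quotients.\<close>

lemma has_C1F_deriv_quotient:
  fixes f :: "'a::frechet_space \<Rightarrow> 'b::frechet_space"
  assumes f: "has_C1F_deriv U f f'" and u: "u \<in> U" and w: "(w \<longlongrightarrow> w0) (at 0)"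
  shows "((\<lambda>t. (1 / t) *\<^sub>R (f (u + t *\<^sub>R w t) - f u)) \<longlongrightarrow> f' u w0) (at 0)"
proof (rule topological_tendstoI)
  fix N assume "open N" "f' u w0 \<in> N"
  then obtain C where C: "open C" "convex C" "f' u w0 \<in> C" "C \<subseteq> N"
    by (rule ex_open_convex_nhd)
  let ?h = "\<lambda>p::real \<times> 'a. u + fst p *\<^sub>R snd p"
  have h: "continuous_on S ?h" for S
    by (intro continuous_intros continuous_on_scaleR_tvs)
  define A where "A = ?h -` U"
  have "open A"
    unfolding A_def by (rule open_vimage[OF has_C1F_derivD(1)[OF f] h])
  moreover have "continuous_on A (\<lambda>p. f' (?h p) (snd p))"
    by (rule continuous_on_compose2[OF has_C1F_deriv_joint_continuous[OF f], of A "\<lambda>p. (?h p, snd p)", simplified])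
      (auto simp: A_def intro!: continuous_intros h)
  ultimately have "open (A \<inter> (\<lambda>p. f' (?h p) (snd p)) -` C)"
    using C(1) by (intro continuous_open_preimage)
  moreover have "(0, w0) \<in> A \<inter> (\<lambda>p. f' (?h p) (snd p)) -` C"
    using u C(3) unfolding A_def by simp
  ultimately obtain R W where RW: "open R" "open W" "(0, w0) \<in> R \<times> W"
      "R \<times> W \<subseteq> A \<inter> (\<lambda>p. f' (?h p) (snd p)) -` C"
    by (rule open_prod_elim)
  obtain d where d: "d > 0" "\<And>r. dist r 0 < d \<Longrightarrow> r \<in> R"
    using RW(1,3) unfolding open_dist by blast
  have main: "(1 / t) *\<^sub>R (f (u + t *\<^sub>R v) - f u) \<in> C" if t: "t \<noteq> 0" "dist t 0 < d" and v: "v \<in> W" for t v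
  proof -
    let ?c = "\<lambda>r. f (u + r *\<^sub>R v)"
    have D: "has_dir_deriv ?c r 1 (f' (u + r *\<^sub>R v) v) \<and> f' (u + r *\<^sub>R v) v \<in> C" if "\<bar>r\<bar> \<le> \<bar>t\<bar>" for r
    proof -
      have "r \<in> R" using that t(2) by (intro d(2)) simp
      then have "(r, v) \<in> A \<inter> (\<lambda>p. f' (?h p) (snd p)) -` C" using RW(4) v by blast
      then have "u + r *\<^sub>R v \<in> U" "f' (u + r *\<^sub>R v) v \<in> C" unfolding A_def by auto
      then show ?thesis using has_dir_deriv_along_line has_C1F_derivD(6)[OF f] by blast
    qed
    show ?thesis
    proof (cases "t > 0")
      case True
      then show ?thesis
        using mean_value_convex[OF True C(1,2), of ?c "\<lambda>r. f' (u + r *\<^sub>R v) v"] D by simp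
    next
      case False
      \<comment> \<open>For negative \<open>t\<close> the mean value theorem is applied on
        \<open>[t, 0]\<close>; reversing both differences leaves the quotient unchanged.\<close>
      then have neg: "t < 0" using t(1) by simp
      have "(1 / (0 - t)) *\<^sub>R (?c 0 - ?c t) \<in> C"
        by (rule mean_value_convex[OF neg C(1,2), of ?c "\<lambda>r. f' (u + r *\<^sub>R v) v"]) (use D in simp)
      moreover have "(1 / (0 - t)) *\<^sub>R (?c 0 - ?c t) = (1 / t) *\<^sub>R (?c t - ?c 0)"
        using difference_quotient_swap[of 0 t "?c 0" "?c t"] by (simp only: diff_0_right)
      ultimately show ?thesis by simp
    qed
  qed
  have "\<forall>\<^sub>F t in at 0. w t \<in> W"
    using w RW(2,3) by (auto dest: topological_tendstoD)
  moreover have "\<forall>\<^sub>F t::real in at 0. t \<noteq> 0 \<and> dist t 0 < d"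
    unfolding eventually_at using d(1) by blast
  ultimately show "\<forall>\<^sub>F t in at 0. (1 / t) *\<^sub>R (f (u + t *\<^sub>R w t) - f u) \<in> N"
    by eventually_elim (use main C(4) in blast)
qed

text \<open>The difference quotients of \<open>c\<close> serve as the varying directions of the
  preceding lemma. Since \<open>c\<close> is differentiated at one point in one direction, the
  statement also applies to curves.\<close>

lemma has_dir_deriv_compose:
  fixes f :: "'a::frechet_space \<Rightarrow> 'b::frechet_space" and c :: "'c::real_tvs \<Rightarrow> 'a"
  assumes f: "has_C1F_deriv U f f'" and c: "has_dir_deriv c p v d" and U: "c p \<in> U"
  shows "has_dir_deriv (\<lambda>q. f (c q)) p v (f' (c p) d)"
  unfolding has_dir_deriv_def
proof (rule Lim_transform_eventually)
  let ?w = "\<lambda>t. (1 / t) *\<^sub>R (c (p + t *\<^sub>R v) - c p)"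
  show "((\<lambda>t. (1 / t) *\<^sub>R (f (c p + t *\<^sub>R ?w t) - f (c p))) \<longlongrightarrow> f' (c p) d) (at 0)"
    using c unfolding has_dir_deriv_def by (rule has_C1F_deriv_quotient[OF f U])
  show "\<forall>\<^sub>F t in at 0. (1 / t) *\<^sub>R (f (c p + t *\<^sub>R ?w t) - f (c p)) =
      (1 / t) *\<^sub>R (f (c (p + t *\<^sub>R v)) - f (c p))"
    using eventually_neq_at_within[of 0 0 UNIV] by eventually_elim simp
qed

lemma cont_linear_compose:
  assumes "A \<in> cont_linear" "B \<in> cont_linear"
  shows "(\<lambda>v. B (A v)) \<in> cont_linear"
  using assms linear_compose[of A B] continuous_on_compose2[of UNIV B UNIV A]
  unfolding cont_linear_def comp_def by auto

lemma has_C1F_deriv_compose: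
  assumes f: "has_C1F_deriv U f f'" and h: "has_C1F_deriv V h h'" and UV: "f ` U \<subseteq> V"
  shows "has_C1F_deriv U (\<lambda>u. h (f u)) (\<lambda>u v. h' (f u) (f' u v))"
  unfolding has_C1F_deriv_def
proof (intro conjI ballI allI impI)
  show "open U" by (rule has_C1F_derivD(1)[OF f])
  show "continuous_on U (\<lambda>u. h (f u))"
    by (rule continuous_on_compose2[OF has_C1F_derivD(2)[OF h] has_C1F_derivD(2)[OF f] UV])
  fix u assume u: "u \<in> U"
  then have fu: "f u \<in> V" using UV by blast
  show "(\<lambda>v. h' (f u) (f' u v)) \<in> cont_linear"
    by (rule cont_linear_compose[OF has_C1F_derivD(3)[OF f u] has_C1F_derivD(3)[OF h fu]])
  show "has_dir_deriv (\<lambda>u. h (f u)) u v (h' (f u) (f' u v))" for v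
    by (rule has_dir_deriv_compose[OF h has_C1F_derivD(6)[OF f u] fu])
next
  fix X u and v :: "nat \<Rightarrow> 'a"
  assume "range X \<subseteq> U \<and> u \<in> U \<and> X \<longlonglongrightarrow> u \<and> tvs_bounded (range v)"
  then have X: "\<And>n. X n \<in> U" "u \<in> U" "X \<longlonglongrightarrow> u" and v: "tvs_bounded (range v)" by auto
  \<comment> \<open>The error splits into \<open>h' (f (X n))\<close> applied to the null sequence
    \<open>?w\<close>, and the change from \<open>h' (f u)\<close> to \<open>h' (f (X n))\<close> on
    the vectors \<open>f' u (v n)\<close>. The latter form a bounded set, as images of a bounded set
    under a continuous linear map.\<close>
  let ?w = "\<lambda>n. f' (X n) (v n) - f' u (v n)"
  have fX: "(\<lambda>n. f (X n)) \<longlonglongrightarrow> f u"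
    using X by (intro continuous_on_tendsto_compose[OF has_C1F_derivD(2)[OF f]]) auto
  have V: "f (X n) \<in> V" "f u \<in> V" for n using UV X by auto
  have w: "?w \<longlonglongrightarrow> 0" by (rule has_C1F_derivD(7)[OF f X v])
  have "(\<lambda>n. h' (f (X n)) (?w n)) \<longlonglongrightarrow> h' (f u) 0"
    by (rule has_C1F_deriv_joint_seq[OF h V fX w])
  moreover have "tvs_bounded (range (\<lambda>n. f' u (v n)))"
    using tvs_bounded_image[OF has_C1F_derivD(3)[OF f X(2)] v] by (simp add: image_image)
  then have "(\<lambda>n. h' (f (X n)) (f' u (v n)) - h' (f u) (f' u (v n))) \<longlonglongrightarrow> 0"
    by (rule has_C1F_derivD(7)[OF h V fX])
  ultimately have "(\<lambda>n. h' (f (X n)) (?w n) +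
      (h' (f (X n)) (f' u (v n)) - h' (f u) (f' u (v n)))) \<longlonglongrightarrow> h' (f u) 0 + 0"
    by (rule tendsto_add)
  then show "(\<lambda>n. h' (f (X n)) (f' (X n) (v n)) - h' (f u) (f' u (v n))) \<longlonglongrightarrow> 0"
    using has_C1F_derivD(4)[OF h] V by (simp add: linear_diff linear_0)
qed

section \<open>Restriction, congruence, sums and linear maps\<close>

lemma has_C1F_deriv_subset:
  assumes "has_C1F_deriv U f f'" "open V" "V \<subseteq> U"
  shows "has_C1F_deriv V f f'"
  using assms continuous_on_subset[of U f V] unfolding has_C1F_deriv_def
  by (auto; blast)

lemma has_C1F_deriv_cong:
  assumes f: "has_C1F_deriv U f f'" and eq: "\<And>u. u \<in> U \<Longrightarrow> f u = h u"
  shows "has_C1F_deriv U h f'"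
proof -
  have "has_dir_deriv h u v (f' u v)" if u: "u \<in> U" for u v
    unfolding has_dir_deriv_def
  proof (rule Lim_transform_eventually)
    show "((\<lambda>t. (1 / t) *\<^sub>R (f (u + t *\<^sub>R v) - f u)) \<longlongrightarrow> f' u v) (at 0)"
      using has_C1F_derivD(6)[OF f u] unfolding has_dir_deriv_def .
    have "((\<lambda>t. u + t *\<^sub>R v) \<longlongrightarrow> u + 0 *\<^sub>R v) (at 0)"
      by (intro tendsto_intros tendsto_scaleR_tvs)
    then have "\<forall>\<^sub>F t in at 0. u + t *\<^sub>R v \<in> U"
      using has_C1F_derivD(1)[OF f] u by (auto dest: topological_tendstoD)
    then show "\<forall>\<^sub>F t in at 0. (1 / t) *\<^sub>R (f (u + t *\<^sub>R v) - f u) =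
        (1 / t) *\<^sub>R (h (u + t *\<^sub>R v) - h u)"
      by eventually_elim (use eq u in simp)
  qed
  then show ?thesis
    using f continuous_on_cong[of U U f h] eq unfolding has_C1F_deriv_def by auto
qed

lemma has_C1F_deriv_add:
  assumes f: "has_C1F_deriv U f f'" and h: "has_C1F_deriv U h h'"
  shows "has_C1F_deriv U (\<lambda>u. f u + h u) (\<lambda>u v. f' u v + h' u v)"
  unfolding has_C1F_deriv_def
proof (intro conjI ballI allI impI)
  show "open U" by (rule has_C1F_derivD(1)[OF f])
  show "continuous_on U (\<lambda>u. f u + h u)"
    by (intro continuous_on_add has_C1F_derivD(2)[OF f] has_C1F_derivD(2)[OF h])
  fix u assume u: "u \<in> U"
  show "(\<lambda>v. f' u v + h' u v) \<in> cont_linear"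
    using has_C1F_derivD(4,5)[OF f u] has_C1F_derivD(4,5)[OF h u] unfolding cont_linear_def
    by (auto intro!: linear_compose_add continuous_on_add)
  show "has_dir_deriv (\<lambda>u. f u + h u) u v (f' u v + h' u v)" for v
    using tendsto_add[OF has_C1F_derivD(6)[OF f u, unfolded has_dir_deriv_def]
        has_C1F_derivD(6)[OF h u, unfolded has_dir_deriv_def]]
    unfolding has_dir_deriv_def by (simp only: scaleR_add_right[symmetric] add_diff_add)
next
  fix X u and v :: "nat \<Rightarrow> 'a"
  assume "range X \<subseteq> U \<and> u \<in> U \<and> X \<longlonglongrightarrow> u \<and> tvs_bounded (range v)"
  then have X: "\<And>n. X n \<in> U" "u \<in> U" "X \<longlonglongrightarrow> u" and v: "tvs_bounded (range v)" by auto
  show "(\<lambda>n. (f' (X n) (v n) + h' (X n) (v n)) - (f' u (v n) + h' u (v n))) \<longlonglongrightarrow> 0"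
    using tendsto_add[OF has_C1F_derivD(7)[OF f X v] has_C1F_derivD(7)[OF h X v]]
    by (simp only: add_diff_add add_0)
qed

lemma has_C1F_deriv_linear:
  assumes "open U" and A: "A \<in> cont_linear"
  shows "has_C1F_deriv U A (\<lambda>_. A)"
proof -
  have "has_dir_deriv A u v (A v)" for u v
    unfolding has_dir_deriv_def
  proof (rule Lim_transform_eventually[OF tendsto_const])
    show "\<forall>\<^sub>F t in at 0. A v = (1 / t) *\<^sub>R (A (u + t *\<^sub>R v) - A u)"
      using eventually_neq_at_within[of 0 0 UNIV]
      by eventually_elim (use A in \<open>simp add: cont_linear_def linear_add linear_scale\<close>)
  qed
  then show ?thesis
    using assms continuous_on_subset[of UNIV A U] unfolding has_C1F_deriv_def cont_linear_def by auto
qed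

lemma has_C1F_deriv_const:
  assumes "open U"
  shows "has_C1F_deriv U (\<lambda>_. k) (\<lambda>_ _. 0)"
  using assms linear_zero unfolding has_C1F_deriv_def has_dir_deriv_def cont_linear_def by auto

lemma cont_linear_id: "(\<lambda>v. v) \<in> cont_linear"
  unfolding cont_linear_def using linear_id by (simp add: id_def)

lemma cont_linear_scaleR: "(\<lambda>t::real. t *\<^sub>R e) \<in> cont_linear"
  unfolding cont_linear_def
  by (auto intro!: continuous_on_scaleR_tvs continuous_intros linearI simp: scaleR_add_left)

text \<open>Both the straightening maps and their inverses have this form, with different scalar
  functions.\<close>

lemma has_C1F_deriv_add_scaled:
  assumes s: "has_C1F_deriv U s s'"
  shows "has_C1F_deriv U (\<lambda>u. u + s u *\<^sub>R e) (\<lambda>u v. v + s' u v *\<^sub>R e)"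
  by (intro has_C1F_deriv_add has_C1F_deriv_linear[OF has_C1F_derivD(1)[OF s] cont_linear_id]
      has_C1F_deriv_compose[OF s has_C1F_deriv_linear[OF open_UNIV cont_linear_scaleR]]) simp


section \<open>Scalar functions and local diffeomorphisms\<close>

lemma has_dir_deriv_real_iff:
  fixes h :: "real \<Rightarrow> real"
  shows "has_dir_deriv h r 1 d \<longleftrightarrow> (h has_real_derivative d) (at r)"
  unfolding has_dir_deriv_def DERIV_def by simp

lemma has_C1F_deriv_line_DERIV:
  fixes s :: "'a::frechet_space \<Rightarrow> real"
  assumes s: "has_C1F_deriv U s s'" and "w + r *\<^sub>R e \<in> U"
  shows "((\<lambda>r. s (w + r *\<^sub>R e)) has_real_derivative s' (w + r *\<^sub>R e) e) (at r)"
  using has_dir_deriv_along_line[OF has_C1F_derivD(6)[OF assms]]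
  unfolding has_dir_deriv_real_iff .

text \<open>The one-variable mean value theorem on the segment from \<open>a\<close> to
  \<open>b\<close>. For real values it gives an exact intermediate point, which convexity keeps in
  \<open>C\<close>.\<close>

lemma scalar_mean_value:
  fixes s :: "'a::frechet_space \<Rightarrow> real"
  assumes s: "has_C1F_deriv U s s'" and C: "convex C" "C \<subseteq> U" and ab: "a \<in> C" "b \<in> C"
  shows "\<exists>\<xi>\<in>C. s b - s a = s' \<xi> (b - a)"
proof -
  have inC: "a + r *\<^sub>R (b - a) \<in> C" if "0 \<le> r" "r \<le> 1" for r
    using convexD_alt[OF C(1) ab that] by (simp add: algebra_simps)
  have "\<exists>z. 0 < z \<and> z < 1 \<and> s (a + 1 *\<^sub>R (b - a)) - s (a + 0 *\<^sub>R (b - a)) =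
      (1 - 0) * s' (a + z *\<^sub>R (b - a)) (b - a)"
    by (rule MVT2[OF zero_less_one has_C1F_deriv_line_DERIV[OF s subsetD[OF C(2) inC]]])
  then obtain z where "0 < z" "z < 1" "s b - s a = s' (a + z *\<^sub>R (b - a)) (b - a)"
    by auto
  then show ?thesis using inC[of z] by (intro bexI) auto
qed

section \<open>The scalar implicit equation\<close>

lemma has_C1F_deriv_slice_continuous:
  assumes "has_C1F_deriv U f f'"
  shows "continuous_on U (\<lambda>u. f' u v)"
  by (rule continuous_on_compose2[OF has_C1F_deriv_joint_continuous[OF assms], of U "\<lambda>u. (u, v)", simplified])
    (auto intro!: continuous_intros)

text \<open>A continuous solution is automatically differentiable. If \<Delta> is the increment of
  \<tau> from \<open>w\<close> to \<open>w + t v\<close>, the scalar mean value theorem yields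
  \<open>- \<Delta> = s' \<xi> (t v + \<Delta> e)\<close>. Solving this linear equation for
  \<open>\<Delta> / t\<close> gives the asserted formula evaluated at \<xi>, and continuity of
  \<tau> forces \<xi> towards \<open>w + \<tau> w e\<close>.\<close>

lemma has_C1F_deriv_implicit_scalar:
  fixes s :: "'a::frechet_space \<Rightarrow> real"
  assumes s: "has_C1F_deriv U s s'" and nz: "\<And>y. y \<in> U \<Longrightarrow> 1 + s' y e \<noteq> 0"
    and W: "open W" and \<tau>: "continuous_on W \<tau>"
    and sol: "\<And>w. w \<in> W \<Longrightarrow> w + \<tau> w *\<^sub>R e \<in> U \<and> \<tau> w = - s (w + \<tau> w *\<^sub>R e)"
  shows "has_C1F_deriv W \<tau> (\<lambda>w v. - (s' (w + \<tau> w *\<^sub>R e) v / (1 + s' (w + \<tau> w *\<^sub>R e) e)))"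
  unfolding has_C1F_deriv_def
proof (intro conjI ballI allI impI)
  show "open W" "continuous_on W \<tau>" by fact+
  fix w assume w: "w \<in> W"
  define y where "y = w + \<tau> w *\<^sub>R e"
  have y: "y \<in> U" using sol[OF w] unfolding y_def by blast
  have "linear (\<lambda>v. - (s' y v / (1 + s' y e)))"
    using has_C1F_derivD(4)[OF s y] by (auto intro!: linearI simp: linear_add linear_scale add_divide_distrib)
  moreover have "continuous_on UNIV (\<lambda>v. - (s' y v / (1 + s' y e)))"
    by (intro continuous_on_minus continuous_on_divide has_C1F_derivD(5)[OF s y] continuous_on_const ballI nz y)
  ultimately show "(\<lambda>v. - (s' (w + \<tau> w *\<^sub>R e) v / (1 + s' (w + \<tau> w *\<^sub>R e) e))) \<in> cont_linear"
    unfolding cont_linear_def y_def by simp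
  fix v
  \<comment> \<open>The difference quotient of \<tau> will be exactly \<open>q \<xi>\<close> for
    some \<xi> in a small convex neighbourhood of \<open>y\<close>, so continuity of
    \<open>q\<close> at \<open>y\<close> gives the limit.\<close>
  define q where "q = (\<lambda>\<xi>. - (s' \<xi> v / (1 + s' \<xi> e)))"
  have "((\<lambda>t. (1 / t) *\<^sub>R (\<tau> (w + t *\<^sub>R v) - \<tau> w)) \<longlongrightarrow> q y) (at 0)"
  proof (rule topological_tendstoI)
    fix N assume N: "open N" "q y \<in> N"
    have "continuous_on U q"
      unfolding q_def
      by (intro continuous_on_minus continuous_on_divide continuous_on_add continuous_on_const
          has_C1F_deriv_slice_continuous[OF s] ballI nz)
    then have "open (U \<inter> q -` N)"
      using has_C1F_derivD(1)[OF s] N(1) by (intro continuous_open_preimage)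
    moreover have "y \<in> U \<inter> q -` N" using N(2) y by simp
    ultimately obtain C where C: "open C" "convex C" "y \<in> C" "C \<subseteq> U \<inter> q -` N"
      by (rule ex_open_convex_nhd)
    have wt: "((\<lambda>t. w + t *\<^sub>R v) \<longlongrightarrow> w) (at 0)"
    proof -
      have "((\<lambda>t. w + t *\<^sub>R v) \<longlongrightarrow> w + 0 *\<^sub>R v) (at 0)"
        by (intro tendsto_intros tendsto_scaleR_tvs)
      then show ?thesis by simp
    qed
    have evW: "\<forall>\<^sub>F t in at 0. w + t *\<^sub>R v \<in> W"
      using wt W w by (auto dest: topological_tendstoD)
    have "((\<lambda>t. \<tau> (w + t *\<^sub>R v)) \<longlongrightarrow> \<tau> w) (at 0)"
      by (rule continuous_on_tendsto_compose[OF \<tau> wt w evW])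
    then have "((\<lambda>t. (w + t *\<^sub>R v) + \<tau> (w + t *\<^sub>R v) *\<^sub>R e) \<longlongrightarrow> y) (at 0)"
      unfolding y_def by (intro tendsto_add wt tendsto_scaleR_tvs tendsto_const)
    then have "\<forall>\<^sub>F t in at 0. (w + t *\<^sub>R v) + \<tau> (w + t *\<^sub>R v) *\<^sub>R e \<in> C"
      using C(1,3) by (auto dest: topological_tendstoD)
    with evW show "\<forall>\<^sub>F t in at 0. (1 / t) *\<^sub>R (\<tau> (w + t *\<^sub>R v) - \<tau> w) \<in> N"
      using eventually_neq_at_within[of 0 0 UNIV]
    proof eventually_elim
      case (elim t)
      define \<Delta> where "\<Delta> = \<tau> (w + t *\<^sub>R v) - \<tau> w"
      define yt where "yt = (w + t *\<^sub>R v) + \<tau> (w + t *\<^sub>R v) *\<^sub>R e"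
      obtain \<xi> where \<xi>: "\<xi> \<in> C" "s yt - s y = s' \<xi> (yt - y)"
        using scalar_mean_value[OF s C(2), of y yt] C(3,4) elim(2) unfolding yt_def by blast
      have \<xi>U: "\<xi> \<in> U" "q \<xi> \<in> N" using C(4) \<xi>(1) by auto
      have "yt - y = t *\<^sub>R v + \<Delta> *\<^sub>R e"
        unfolding yt_def y_def \<Delta>_def by (simp add: algebra_simps)
      moreover have "s yt = - \<tau> (w + t *\<^sub>R v)" "s y = - \<tau> w"
        using sol[OF elim(1)] sol[OF w] unfolding yt_def y_def by auto
      ultimately have "- \<Delta> = t * s' \<xi> v + \<Delta> * s' \<xi> e"
        using \<xi>(2) has_C1F_derivD(4)[OF s \<xi>U(1)] unfolding \<Delta>_def
        by (simp add: linear_add linear_scale)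
      then have "\<Delta> * (1 + s' \<xi> e) = - (t * s' \<xi> v)"
        by (simp add: algebra_simps)
      then have "\<Delta> = - (t * s' \<xi> v) / (1 + s' \<xi> e)"
        by (simp only: nonzero_eq_divide_eq[OF nz[OF \<xi>U(1)]])
      then have "(1 / t) *\<^sub>R \<Delta> = q \<xi>"
        unfolding q_def using elim(3) by simp
      then show ?case using \<xi>U(2) unfolding \<Delta>_def by simp
    qed
  qed
  then show "has_dir_deriv \<tau> w v (- (s' (w + \<tau> w *\<^sub>R e) v / (1 + s' (w + \<tau> w *\<^sub>R e) e)))"
    unfolding has_dir_deriv_def q_def y_def .
next
  fix X w and v :: "nat \<Rightarrow> 'a"
  assume "range X \<subseteq> W \<and> w \<in> W \<and> X \<longlonglongrightarrow> w \<and> tvs_bounded (range v)"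
  then have X: "\<And>n. X n \<in> W" "w \<in> W" "X \<longlonglongrightarrow> w" and v: "tvs_bounded (range v)" by auto
  define y where "y = w + \<tau> w *\<^sub>R e"
  define Y where "Y = (\<lambda>n. X n + \<tau> (X n) *\<^sub>R e)"
  \<comment> \<open>The derivative at \<open>w\<close> is \<open>k * s' y v\<close>, and at
    \<open>X n\<close> it is \<open>K n * s' (Y n) v\<close>. Their difference is a convergent
    factor times a null sequence, plus the null sequence \<open>K n - k\<close> times a bounded
    sequence.\<close>
  define k where "k = - 1 / (1 + s' y e)"
  define K where "K = (\<lambda>n. - 1 / (1 + s' (Y n) e))"
  have Y: "\<And>n. Y n \<in> U" "y \<in> U" using sol X unfolding Y_def y_def by auto
  have "(\<lambda>n. \<tau> (X n)) \<longlonglongrightarrow> \<tau> w"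
    using X by (intro continuous_on_tendsto_compose[OF \<tau>]) auto
  then have "Y \<longlonglongrightarrow> y"
    unfolding Y_def y_def by (intro tendsto_add X tendsto_scaleR_tvs tendsto_const)
  note Y = Y this
  have K: "K \<longlonglongrightarrow> k"
    unfolding K_def k_def
    by (intro tendsto_divide tendsto_add tendsto_const has_C1F_deriv_joint_seq[OF s Y] nz Y)
  have "(\<lambda>n. K n - k) \<longlonglongrightarrow> 0"
    using K by (simp add: LIM_zero)
  moreover have "tvs_bounded (range (\<lambda>n. s' y (v n)))"
    using tvs_bounded_image[OF has_C1F_derivD(3)[OF s Y(2)] v] by (simp add: image_image)
  ultimately have "(\<lambda>n. (K n - k) *\<^sub>R s' y (v n)) \<longlonglongrightarrow> 0"
    by (intro tvs_bounded_mult_null)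
  then have "(\<lambda>n. K n * (s' (Y n) (v n) - s' y (v n)) + (K n - k) * s' y (v n)) \<longlonglongrightarrow> k * 0 + 0"
    by (intro tendsto_add tendsto_mult K has_C1F_derivD(7)[OF s Y v]) simp
  moreover have "K n * (s' (Y n) (v n) - s' y (v n)) + (K n - k) * s' y (v n) =
      - (s' (Y n) (v n) / (1 + s' (Y n) e)) - - (s' y (v n) / (1 + s' y e))" for n
    unfolding K_def k_def by (simp add: right_diff_distrib left_diff_distrib)
  ultimately show "(\<lambda>n. - (s' (X n + \<tau> (X n) *\<^sub>R e) (v n) / (1 + s' (X n + \<tau> (X n) *\<^sub>R e) e)) -
      - (s' (w + \<tau> w *\<^sub>R e) (v n) / (1 + s' (w + \<tau> w *\<^sub>R e) e))) \<longlonglongrightarrow> 0"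
    unfolding Y_def y_def by simp
qed

text \<open>For fixed \<open>w\<close> the function \<open>r + s (w + r e)\<close> of
  \<open>r\<close> has derivative \<open>1 + s' e > 0\<close>, so it is strictly increasing. A sign
  change between two fixed endpoints gives a zero by the intermediate value theorem; monotonicity
  gives its uniqueness and its continuous dependence on \<open>w\<close>.\<close>

lemma ex_implicit_scalar:
  fixes s :: "'a::frechet_space \<Rightarrow> real"
  assumes s: "has_C1F_deriv U s s'" and pos: "\<And>y. y \<in> U \<Longrightarrow> 1 + s' y e > 0" and y0: "y0 \<in> U"
  obtains W \<tau> \<eta> where "open W" "continuous_on W \<tau>" "\<eta> > 0" "y0 + s y0 *\<^sub>R e \<in> W"
    "\<And>w. w \<in> W \<Longrightarrow> w + \<tau> w *\<^sub>R e \<in> U \<and> \<tau> w = - s (w + \<tau> w *\<^sub>R e) \<and> \<bar>\<tau> w + s y0\<bar> < \<eta>"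
    "\<And>w r. w \<in> W \<Longrightarrow> \<bar>r + s y0\<bar> < \<eta> \<Longrightarrow> r = - s (w + r *\<^sub>R e) \<Longrightarrow> r = \<tau> w"
proof -
  \<comment> \<open>\<open>w0\<close> is the image of \<open>y0\<close> under
    \<open>y \<mapsto> y + s y e\<close>, and \<open>r0\<close> is the solution of the equation at
    \<open>w0\<close>.\<close>
  define r0 where "r0 = - s y0"
  define w0 where "w0 = y0 + s y0 *\<^sub>R e"
  have y0_eq: "w0 + r0 *\<^sub>R e = y0" unfolding w0_def r0_def by simp
  let ?h = "\<lambda>p::'a \<times> real. fst p + snd p *\<^sub>R e"
  have "open (?h -` U)"
    by (rule open_vimage[OF has_C1F_derivD(1)[OF s]])
      (intro continuous_intros continuous_on_scaleR_tvs)
  moreover have "(w0, r0) \<in> ?h -` U" using y0 y0_eq by simp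
  ultimately obtain Wa R where Wa: "open Wa" "open R" "(w0, r0) \<in> Wa \<times> R" "Wa \<times> R \<subseteq> ?h -` U"
    by (rule open_prod_elim)
  obtain \<eta> where \<eta>: "\<eta> > 0" "cball r0 \<eta> \<subseteq> R"
    using Wa(2,3) open_contains_cball by blast
  have inU: "w + r *\<^sub>R e \<in> U" if "w \<in> Wa" "\<bar>r - r0\<bar> \<le> \<eta>" for w r
  proof -
    have "r \<in> R" using \<eta>(2) that(2) by (auto simp: dist_real_def abs_minus_commute)
    then show ?thesis using Wa(4) that(1) by auto
  qed
  define f where "f = (\<lambda>w r. r + s (w + r *\<^sub>R e))"
  have mono: "f w r < f w r'" if w: "w \<in> Wa" and r: "\<bar>r - r0\<bar> \<le> \<eta>" "\<bar>r' - r0\<bar> \<le> \<eta>" "r < r'" for w r r'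
  proof (rule DERIV_pos_imp_increasing[OF r(3)])
    fix x assume "r \<le> x" "x \<le> r'"
    then have U: "w + x *\<^sub>R e \<in> U" using r by (intro inU[OF w]) auto
    have "(f w has_real_derivative 1 + s' (w + x *\<^sub>R e) e) (at x)"
      unfolding f_def by (intro DERIV_add DERIV_ident has_C1F_deriv_line_DERIV[OF s U])
    then show "\<exists>y. (f w has_real_derivative y) (at x) \<and> 0 < y"
      using pos[OF U] by blast
  qed
  have cont: "continuous_on Wa (\<lambda>w. f w r)" if "\<bar>r - r0\<bar> \<le> \<eta>" for r
    unfolding f_def
    by (intro continuous_on_add continuous_on_const continuous_on_compose2[OF has_C1F_derivD(2)[OF s]]
        continuous_on_id) (use inU that in auto)
  \<comment> \<open>Opposite signs at \<open>r0 - \<eta>\<close> and \<open>r0 + \<eta>\<close> are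
    an open condition on \<open>w\<close>. It holds at \<open>w0\<close> because the increasing
    function \<open>f w0\<close> vanishes at \<open>r0\<close>.\<close>
  define W where "W = (Wa \<inter> (\<lambda>w. f w (r0 - \<eta>)) -` {..<0}) \<inter> (Wa \<inter> (\<lambda>w. f w (r0 + \<eta>)) -` {0<..})"
  have W: "open W"
    unfolding W_def using \<eta>(1) by (intro open_Int continuous_open_preimage cont Wa) auto
  have "f w0 r0 = 0" unfolding f_def y0_eq by (simp add: r0_def)
  then have w0W: "w0 \<in> W"
    using mono[of w0 "r0 - \<eta>" r0] mono[of w0 r0 "r0 + \<eta>"] Wa(3) \<eta>(1) unfolding W_def by auto
  have ex: "\<exists>r. \<bar>r - r0\<bar> < \<eta> \<and> f w r = 0" if w: "w \<in> W" for w
  proof -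
    have wa: "w \<in> Wa" "f w (r0 - \<eta>) < 0" "0 < f w (r0 + \<eta>)" using w unfolding W_def by auto
    have "\<exists>r\<ge>r0 - \<eta>. r \<le> r0 + \<eta> \<and> f w r = 0"
    proof (rule IVT')
      show "continuous_on {r0 - \<eta>..r0 + \<eta>} (f w)"
        unfolding f_def
        by (intro continuous_on_add continuous_on_id continuous_on_compose2[OF has_C1F_derivD(2)[OF s]]
            continuous_on_const continuous_on_scaleR_tvs) (use inU[OF wa(1)] in auto)
    qed (use wa \<eta>(1) in auto)
    then obtain r where r: "r0 - \<eta> \<le> r" "r \<le> r0 + \<eta>" "f w r = 0" by blast
    moreover have "r \<noteq> r0 - \<eta>" "r \<noteq> r0 + \<eta>" using wa r(3) by auto
    ultimately show ?thesis by (intro exI[of _ r]) auto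
  qed
  then obtain \<tau> where \<tau>: "\<And>w. w \<in> W \<Longrightarrow> \<bar>\<tau> w - r0\<bar> < \<eta>" "\<And>w. w \<in> W \<Longrightarrow> f w (\<tau> w) = 0"
    by metis
  have Wa_W: "w \<in> Wa" if "w \<in> W" for w using that unfolding W_def by blast
  \<comment> \<open>Comparison of \<open>r\<close> with \<open>\<tau> w\<close> is expressed by the
    sign of \<open>f w r\<close>, which for fixed \<open>r\<close> is stable under small changes of
    \<open>w\<close>; continuity of \<tau> follows in its order form.\<close>
  have less: "r < \<tau> w \<longleftrightarrow> f w r < 0" "\<tau> w < r \<longleftrightarrow> 0 < f w r" if w: "w \<in> W" and r: "\<bar>r - r0\<bar> \<le> \<eta>" for w r
    using mono[OF Wa_W[OF w] r, of "\<tau> w"] mono[OF Wa_W[OF w] _ r, of "\<tau> w"] \<tau>[OF w]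
    by (smt (verit))+
  have "continuous_on W \<tau>"
    unfolding continuous_on_def
  proof (intro ballI order_tendstoI)
    fix w a assume w: "w \<in> W" and a: "a < \<tau> w"
    \<comment> \<open>The bound \<open>a\<close> is clipped to the interval of radius \<eta> about
      \<open>r0\<close>, where \<open>less\<close> applies; it stays below \<open>\<tau> w\<close>,
      which lies strictly inside that interval.\<close>
    define b where "b = max a (r0 - \<eta>)"
    have b: "\<bar>b - r0\<bar> \<le> \<eta>" "b < \<tau> w" using a \<tau>(1)[OF w] unfolding b_def by auto
    have "((\<lambda>w. f w b) \<longlongrightarrow> f w b) (at w within W)"
      using continuous_on_subset[OF cont[OF b(1)], of W] Wa_W w unfolding continuous_on_def by blast
    then have "\<forall>\<^sub>F w' in at w within W. f w' b < 0"
      by (rule order_tendstoD) (use less(1)[OF w b(1)] b(2) in simp)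
    moreover have "\<forall>\<^sub>F w' in at w within W. w' \<in> W"
      by (simp add: eventually_at_filter)
    ultimately show "\<forall>\<^sub>F w' in at w within W. a < \<tau> w'"
    proof eventually_elim
      case (elim w')
      then show ?case using less(1)[OF _ b(1), of w'] unfolding b_def by auto
    qed
  next
    fix w a assume w: "w \<in> W" and a: "\<tau> w < a"
    define b where "b = min a (r0 + \<eta>)"
    have b: "\<bar>b - r0\<bar> \<le> \<eta>" "\<tau> w < b" using a \<tau>(1)[OF w] unfolding b_def by auto
    have "((\<lambda>w. f w b) \<longlongrightarrow> f w b) (at w within W)"
      using continuous_on_subset[OF cont[OF b(1)], of W] Wa_W w unfolding continuous_on_def by blast
    then have "\<forall>\<^sub>F w' in at w within W. 0 < f w' b"
      by (rule order_tendstoD) (use less(2)[OF w b(1)] b(2) in simp)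
    moreover have "\<forall>\<^sub>F w' in at w within W. w' \<in> W"
      by (simp add: eventually_at_filter)
    ultimately show "\<forall>\<^sub>F w' in at w within W. \<tau> w' < a"
    proof eventually_elim
      case (elim w')
      then show ?case using less(2)[OF _ b(1), of w'] unfolding b_def by auto
    qed
  qed
  then show ?thesis
  proof (rule that[OF W _ \<eta>(1), of \<tau>])
    show "y0 + s y0 *\<^sub>R e \<in> W" using w0W unfolding w0_def .
    fix w assume w: "w \<in> W"
    show "w + \<tau> w *\<^sub>R e \<in> U \<and> \<tau> w = - s (w + \<tau> w *\<^sub>R e) \<and> \<bar>\<tau> w + s y0\<bar> < \<eta>"
      using inU[OF Wa_W[OF w], of "\<tau> w"] \<tau>[OF w] unfolding f_def r0_def by auto
    show "r = \<tau> w" if "\<bar>r + s y0\<bar> < \<eta>" "r = - s (w + r *\<^sub>R e)" for r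
      using less[OF w, of r] that unfolding f_def r0_def by auto
  qed
qed

section \<open>Pairs of mutually inverse maps\<close>

text \<open>The inverse and both derivatives are explicit data, so that compositions have closed
  formulas free of \<open>inv_into\<close> and \<open>DF\<close>.\<close>

definition C1F_inverse_pair ::
    "'a::frechet_space set \<Rightarrow> 'b::frechet_space set \<Rightarrow> ('a \<Rightarrow> 'b) \<Rightarrow> ('a \<Rightarrow> 'a \<Rightarrow> 'b) \<Rightarrow>
      ('b \<Rightarrow> 'a) \<Rightarrow> ('b \<Rightarrow> 'b \<Rightarrow> 'a) \<Rightarrow> bool" where
  "C1F_inverse_pair V W K K' L L' \<longleftrightarrow> has_C1F_deriv V K K' \<and> has_C1F_deriv W L L' \<and>
     (\<forall>u\<in>V. K u \<in> W \<and> L (K u) = u) \<and> (\<forall>w\<in>W. L w \<in> V \<and> K (L w) = w)"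

lemma C1F_inverse_pairD:
  assumes "C1F_inverse_pair V W K K' L L'"
  shows "has_C1F_deriv V K K'" "has_C1F_deriv W L L'"
    "u \<in> V \<Longrightarrow> K u \<in> W" "u \<in> V \<Longrightarrow> L (K u) = u" "w \<in> W \<Longrightarrow> L w \<in> V" "w \<in> W \<Longrightarrow> K (L w) = w"
  using assms unfolding C1F_inverse_pair_def by auto

text \<open>Chain rule for \<open>L \<circ> K\<close>, which is the identity on the open set
  \<open>V\<close>, and uniqueness of directional derivatives.\<close>

lemma C1F_inverse_pair_deriv:
  assumes pair: "C1F_inverse_pair V W K K' L L'" and u: "u \<in> V"
  shows "L' (K u) (K' u v) = v"
proof -
  note P = C1F_inverse_pairD[OF pair]
  have "has_C1F_deriv V (\<lambda>u. L (K u)) (\<lambda>u v. L' (K u) (K' u v))"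
    by (rule has_C1F_deriv_compose[OF P(1,2)]) (use P(3) in blast)
  then have "has_C1F_deriv V (\<lambda>u. u) (\<lambda>u v. L' (K u) (K' u v))"
    by (rule has_C1F_deriv_cong) (rule P(4))
  then have "has_dir_deriv (\<lambda>u. u) u v (L' (K u) (K' u v))"
    by (rule has_C1F_derivD(6)[OF _ u])
  moreover have "has_dir_deriv (\<lambda>u. u) u v v"
    by (rule has_C1F_derivD(6)[OF has_C1F_deriv_linear[OF open_UNIV cont_linear_id] UNIV_I])
  ultimately show ?thesis by (rule has_dir_deriv_unique)
qed

lemma C1F_inverse_pair_sym:
  "C1F_inverse_pair V W K K' L L' \<Longrightarrow> C1F_inverse_pair W V L L' K K'"
  unfolding C1F_inverse_pair_def by blast

lemma C1F_inverse_pair_compose: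
  assumes KL: "C1F_inverse_pair V W K K' L L'" and PQ: "C1F_inverse_pair V2 W2 P P' Q Q'"
  shows "C1F_inverse_pair (V \<inter> K -` V2) (W2 \<inter> Q -` W) (\<lambda>u. P (K u)) (\<lambda>u v. P' (K u) (K' u v))
    (\<lambda>w. L (Q w)) (\<lambda>w v. L' (Q w) (Q' w v))"
proof -
  note k = C1F_inverse_pairD[OF KL] and p = C1F_inverse_pairD[OF PQ]
  have "open (V \<inter> K -` V2)" "open (W2 \<inter> Q -` W)"
    by (intro continuous_open_preimage has_C1F_derivD(1,2)[OF k(1)] has_C1F_derivD(1,2)[OF k(2)]
        has_C1F_derivD(1,2)[OF p(1)] has_C1F_derivD(1,2)[OF p(2)])+
  then have "has_C1F_deriv (V \<inter> K -` V2) (\<lambda>u. P (K u)) (\<lambda>u v. P' (K u) (K' u v))"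
    "has_C1F_deriv (W2 \<inter> Q -` W) (\<lambda>w. L (Q w)) (\<lambda>w v. L' (Q w) (Q' w v))"
    by (auto intro!: has_C1F_deriv_compose[OF has_C1F_deriv_subset[OF k(1)] p(1)]
        has_C1F_deriv_compose[OF has_C1F_deriv_subset[OF p(2)] k(2)])
  then show ?thesis
    using k p unfolding C1F_inverse_pair_def by auto
qed

lemma C1F_inverse_pair_imp_diffeo:
  assumes pair: "C1F_inverse_pair V W K K' L L'"
  shows "C1F_diffeo V W K"
proof -
  note P = C1F_inverse_pairD[OF pair]
  have bij: "bij_betw K V W"
    by (rule bij_betw_byWitness[where f' = L]) (use P in auto)
  have "L w = inv_into V K w" if w: "w \<in> W" for w
    using bij P(5,6)[OF w] unfolding bij_betw_def by (metis inv_into_f_f)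
  then have inv: "has_C1F_deriv W (inv_into V K) L'"
    by (rule has_C1F_deriv_cong[OF P(2)])
  show ?thesis
    unfolding C1F_diffeo_def
    using bij has_C1F_derivD(1)[OF P(1)] has_C1F_derivD(1)[OF inv]
      has_C1F_deriv_imp_C1F_on[OF P(1)] has_C1F_deriv_imp_C1F_on[OF inv] by blast
qed

lemma C1F_diffeo_imp_inverse_pair:
  assumes "C1F_diffeo V W K"
  shows "C1F_inverse_pair V W K (DF K) (inv_into V K) (DF (inv_into V K))"
proof -
  have bij: "bij_betw K V W" using assms unfolding C1F_diffeo_def by blast
  have "K u \<in> W \<and> inv_into V K (K u) = u" if "u \<in> V" for u
    using bij that by (auto simp: bij_betw_def)
  moreover have "inv_into V K w \<in> V \<and> K (inv_into V K w) = w" if "w \<in> W" for w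
    using bij that by (auto simp: bij_betw_def inv_into_into f_inv_into_f)
  ultimately show ?thesis
    using assms C1F_on_imp_has_C1F_deriv[of V K] C1F_on_imp_has_C1F_deriv[of W "inv_into V K"]
    unfolding C1F_inverse_pair_def C1F_diffeo_def by simp
qed

section \<open>Straightening by scalar corrections\<close>

text \<open>For \<open>w = y + s y e\<close> the number \<open>- s y\<close> solves the implicit
  equation at \<open>w\<close>, so the inverse is \<open>w + \<tau> w e\<close>. Since
  \<open>s' y0 e = 0\<close> and \<open>s' y e\<close> is continuous in \<open>y\<close>, the
  required positivity of \<open>1 + s' y e\<close> holds near \<open>y0\<close>.\<close>

lemma ex_C1F_inverse_pair_add_scaled:
  fixes s :: "'a::frechet_space \<Rightarrow> real"
  assumes s: "has_C1F_deriv U s s'" and y0: "y0 \<in> U" and s0: "s' y0 e = 0"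
  shows "\<exists>V W L L'. y0 \<in> V \<and> V \<subseteq> U \<and>
    C1F_inverse_pair V W (\<lambda>y. y + s y *\<^sub>R e) (\<lambda>y v. v + s' y v *\<^sub>R e) L L'"
proof -
  define U1 where "U1 = U \<inter> (\<lambda>y. s' y e) -` {-1<..}"
  have "open U1"
    unfolding U1_def using has_C1F_derivD(1)[OF s] has_C1F_deriv_slice_continuous[OF s]
    by (intro continuous_open_preimage) auto
  then have s1: "has_C1F_deriv U1 s s'"
    by (rule has_C1F_deriv_subset[OF s]) (simp add: U1_def)
  have pos: "1 + s' y e > 0" if "y \<in> U1" for y
    using that unfolding U1_def by auto
  have "y0 \<in> U1" using y0 s0 unfolding U1_def by simp
  then obtain W \<tau> \<eta> where W: "open W" "continuous_on W \<tau>" "\<eta> > 0" "y0 + s y0 *\<^sub>R e \<in> W"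
    and sol: "\<And>w. w \<in> W \<Longrightarrow> w + \<tau> w *\<^sub>R e \<in> U1 \<and> \<tau> w = - s (w + \<tau> w *\<^sub>R e) \<and> \<bar>\<tau> w + s y0\<bar> < \<eta>"
    and uniq: "\<And>w r. w \<in> W \<Longrightarrow> \<bar>r + s y0\<bar> < \<eta> \<Longrightarrow> r = - s (w + r *\<^sub>R e) \<Longrightarrow> r = \<tau> w"
    using ex_implicit_scalar[OF s1 pos] by blast
  define \<tau>' where "\<tau>' = (\<lambda>w v. - (s' (w + \<tau> w *\<^sub>R e) v / (1 + s' (w + \<tau> w *\<^sub>R e) e)))"
  have \<tau>: "has_C1F_deriv W \<tau> \<tau>'"
    unfolding \<tau>'_def
    by (rule has_C1F_deriv_implicit_scalar[OF s1 less_imp_neq[OF pos, symmetric] W(1,2)])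
      (use sol in auto)
  \<comment> \<open>The second part keeps \<open>- s y\<close> within \<eta> of
    \<open>- s y0\<close>, the range in which \<open>uniq\<close> identifies it with the value of
    \<tau> at \<open>y + s y e\<close>.\<close>
  define V where "V = (U1 \<inter> (\<lambda>y. y + s y *\<^sub>R e) -` W) \<inter> (U1 \<inter> (\<lambda>y. - s y + s y0) -` {-\<eta><..<\<eta>})"
  have "open V"
    unfolding V_def
    by (intro open_Int continuous_open_preimage continuous_on_add continuous_on_minus
        continuous_on_scaleR_tvs continuous_on_const continuous_on_id
        has_C1F_derivD(1,2)[OF s1] W(1) open_greaterThanLessThan)
  then have K: "has_C1F_deriv V (\<lambda>y. y + s y *\<^sub>R e) (\<lambda>y v. v + s' y v *\<^sub>R e)"
    by (intro has_C1F_deriv_subset[OF has_C1F_deriv_add_scaled[OF s1]]) (auto simp: V_def)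
  have VW: "y + s y *\<^sub>R e \<in> W \<and> \<tau> (y + s y *\<^sub>R e) = - s y" if "y \<in> V" for y
    using that uniq[of "y + s y *\<^sub>R e" "- s y"] unfolding V_def by auto
  have WV: "w + \<tau> w *\<^sub>R e \<in> V \<and> s (w + \<tau> w *\<^sub>R e) = - \<tau> w" if w: "w \<in> W" for w
  proof -
    have 1: "w + \<tau> w *\<^sub>R e \<in> U1" "s (w + \<tau> w *\<^sub>R e) = - \<tau> w" "\<bar>\<tau> w + s y0\<bar> < \<eta>"
      using sol[OF w] by auto
    then show ?thesis using w unfolding V_def by auto
  qed
  have "C1F_inverse_pair V W (\<lambda>y. y + s y *\<^sub>R e) (\<lambda>y v. v + s' y v *\<^sub>R e)
      (\<lambda>w. w + \<tau> w *\<^sub>R e) (\<lambda>w v. v + \<tau>' w v *\<^sub>R e)"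
    unfolding C1F_inverse_pair_def using K has_C1F_deriv_add_scaled[OF \<tau>] VW WV by simp
  moreover have "y0 \<in> V" "V \<subseteq> U"
    using \<open>y0 \<in> U1\<close> W(3,4) unfolding V_def U1_def by auto
  ultimately show ?thesis by blast
qed

text \<open>Induction on the number of functions. By duality, adding a multiple of
  \<open>e k\<close> changes the value of \<open>\<phi>' k x\<close> by that multiple and leaves the
  earlier \<open>\<phi>' i x\<close> unchanged. Keeping the derivative at \<open>x\<close> equal to
  the identity makes each further correction have derivative zero there.\<close>

lemma straighten_scalar_functions:
  fixes \<phi> :: "nat \<Rightarrow> 'a::frechet_space \<Rightarrow> real"
  assumes \<phi>: "\<And>i. i < k \<Longrightarrow> has_C1F_deriv U (\<phi> i) (\<phi>' i)" and U: "open U" "x \<in> U"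
    and dual: "\<And>i j. i < k \<Longrightarrow> j < k \<Longrightarrow> \<phi>' i x (e j) = (if i = j then 1 else 0)"
  shows "\<exists>V W \<Psi> \<Psi>' L L'. x \<in> V \<and> V \<subseteq> U \<and> C1F_inverse_pair V W \<Psi> \<Psi>' L L' \<and>
    (\<forall>v. \<Psi>' x v = v) \<and> (\<forall>i<k. \<forall>u\<in>V. \<phi>' i x (\<Psi> u) = \<phi> i u)"
  using \<phi> dual
proof (induction k)
  case 0
  have "C1F_inverse_pair U U (\<lambda>u. u) (\<lambda>_ v. v) (\<lambda>u. u) (\<lambda>_ v. v)"
    unfolding C1F_inverse_pair_def using has_C1F_deriv_linear[OF U(1) cont_linear_id] by auto
  then show ?case using U(2) by blast
next
  case (Suc k)
  have "\<exists>V W \<Psi> \<Psi>' L L'. x \<in> V \<and> V \<subseteq> U \<and> C1F_inverse_pair V W \<Psi> \<Psi>' L L' \<and>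
    (\<forall>v. \<Psi>' x v = v) \<and> (\<forall>i<k. \<forall>u\<in>V. \<phi>' i x (\<Psi> u) = \<phi> i u)"
    by (rule Suc.IH) (use Suc.prems in auto)
  then obtain V W \<Psi> \<Psi>' L L' where V: "x \<in> V" "V \<subseteq> U"
    and pair: "C1F_inverse_pair V W \<Psi> \<Psi>' L L'" and id: "\<And>v. \<Psi>' x v = v"
    and str: "\<And>i u. i < k \<Longrightarrow> u \<in> V \<Longrightarrow> \<phi>' i x (\<Psi> u) = \<phi> i u"
    by blast
  note P = C1F_inverse_pairD[OF pair]
  have k: "has_C1F_deriv U (\<phi> k) (\<phi>' k)" by (rule Suc.prems) simp
  have lin: "linear (\<phi>' i x)" if "i < Suc k" for i
    by (rule has_C1F_derivD(4)[OF Suc.prems(1)[OF that] U(2)])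
  have neg: "(\<lambda>v. - \<phi>' k x v) \<in> cont_linear"
    using has_C1F_derivD(3)[OF k U(2)] unfolding cont_linear_def
    by (auto intro: linear_compose_neg continuous_on_minus)
  \<comment> \<open>\<open>s\<close> is the amount by which \<open>\<phi> k\<close>, transported by
    the chart \<open>\<Psi>\<close> built so far, differs from its linear part
    \<open>\<phi>' k x\<close>.\<close>
  define s where "s = (\<lambda>y. \<phi> k (L y) + - \<phi>' k x y)"
  define s' where "s' = (\<lambda>y v. \<phi>' k (L y) (L' y v) + - \<phi>' k x v)"
  have s: "has_C1F_deriv W s s'"
    unfolding s_def s'_def
    by (intro has_C1F_deriv_add has_C1F_deriv_compose[OF P(2) k]
        has_C1F_deriv_linear[OF has_C1F_derivD(1)[OF P(2)] neg]) (use P(5) V(2) in blast)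
  \<comment> \<open>\<open>\<Psi>' x\<close> is the identity, hence so is
    \<open>L' (\<Psi> x)\<close>, and the two terms of \<open>s'\<close> cancel.\<close>
  have s'0: "s' (\<Psi> x) v = 0" for v
    unfolding s'_def using C1F_inverse_pair_deriv[OF pair V(1), of v] P(4)[OF V(1)] id by simp
  obtain V2 W2 Q Q' where V2: "\<Psi> x \<in> V2" "V2 \<subseteq> W"
    and pair2: "C1F_inverse_pair V2 W2 (\<lambda>y. y + s y *\<^sub>R e k) (\<lambda>y v. v + s' y v *\<^sub>R e k) Q Q'"
    using ex_C1F_inverse_pair_add_scaled[OF s P(3)[OF V(1)] s'0[of "e k"]]
    by (elim exE conjE) (rule that)
  have "\<phi>' i x (\<Psi> u + s (\<Psi> u) *\<^sub>R e k) = \<phi> i u" if "i < Suc k" "u \<in> V" for i u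
  proof (cases "i = k")
    case True
    then show ?thesis
      using lin[of k] Suc.prems(2)[of k k] P(4)[OF that(2)]
      by (simp add: linear_add linear_scale s_def)
  next
    case False
    then show ?thesis
      using lin[OF that(1)] Suc.prems(2)[of i k] that str[of i u]
      by (simp add: linear_add linear_scale)
  qed
  then show ?case
    using C1F_inverse_pair_compose[OF pair pair2] V V2 id s'0
    by (intro exI[of _ "V \<inter> \<Psi> -` V2"] exI[of _ "W2 \<inter> Q -` W"] exI[of _ "\<lambda>u. \<Psi> u + s (\<Psi> u) *\<^sub>R e k"]
        exI[of _ "\<lambda>u v. \<Psi>' u v + s' (\<Psi> u) (\<Psi>' u v) *\<^sub>R e k"] exI[of _ "\<lambda>w. L (Q w)"]
        exI[of _ "\<lambda>w v. L' (Q w) (Q' w v)"]) auto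
qed


section \<open>Closed subspaces of finite codimension\<close>

text \<open>Otherwise some \<open>z n + t n e\<close> tends to \<open>0\<close> with
  \<open>\<bar>t n\<bar> \<ge> \<epsilon>\<close>. The reciprocals \<open>1 / t n\<close> are
  bounded, so dividing and passing to a subsequence gives elements of \<open>Z\<close> tending to
  \<open>- e\<close>, against closedness of \<open>Z\<close>.\<close>

lemma closed_subspace_coefficient_small:
  fixes Z :: "'a::frechet_space set"
  assumes Z: "subspace Z" "closed Z" and e: "e \<notin> Z" and \<epsilon>: "\<epsilon> > 0"
  shows "\<exists>d>0. \<forall>z\<in>Z. \<forall>t. dist (z + t *\<^sub>R e) 0 < d \<longrightarrow> \<bar>t\<bar> < \<epsilon>"
proof (rule ccontr)
  assume neg: "\<not> ?thesis"
  have "\<exists>z t. z \<in> Z \<and> dist (z + t *\<^sub>R e) 0 < inverse (real (Suc n)) \<and> \<bar>t\<bar> \<ge> \<epsilon>" for n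
    using neg by (meson inverse_positive_iff_positive linorder_not_less of_nat_0_less_iff zero_less_Suc)
  then obtain z t where zt: "\<And>n. z n \<in> Z" "\<And>n. \<bar>t n\<bar> \<ge> \<epsilon>"
    "\<And>n. dist (z n + t n *\<^sub>R e) 0 < inverse (real (Suc n))"
    by metis
  define w where "w = (\<lambda>n. z n + t n *\<^sub>R e)"
  have w: "w \<longlonglongrightarrow> 0"
    unfolding tendsto_dist_iff[of w]
    by (rule real_tendsto_sandwich[OF _ _ tendsto_const LIMSEQ_inverse_real_of_nat])
      (use zt(3) in \<open>auto simp: w_def intro!: always_eventually less_imp_le\<close>)
  have t0: "t n \<noteq> 0" for n using zt(2)[of n] \<epsilon> by auto
  have "bounded (range (\<lambda>n. 1 / t n))"
    unfolding bounded_iff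
  proof (intro exI ballI)
    fix a assume "a \<in> range (\<lambda>n. 1 / t n)"
    then show "norm a \<le> 1 / \<epsilon>"
      using zt(2) \<epsilon> by (auto intro!: frac_le)
  qed
  then obtain l r where r: "strict_mono (r :: nat \<Rightarrow> nat)" "((\<lambda>n. 1 / t n) \<circ> r) \<longlonglongrightarrow> l"
    using bounded_imp_convergent_subsequence by blast
  have "(\<lambda>n. (1 / t (r n)) *\<^sub>R w (r n) - e) \<longlonglongrightarrow> l *\<^sub>R 0 - e"
    using r(2) LIMSEQ_subseq_LIMSEQ[OF w r(1)] unfolding comp_def
    by (intro tendsto_diff tendsto_scaleR_tvs tendsto_const)
  moreover have "(1 / t (r n)) *\<^sub>R w (r n) - e = (1 / t (r n)) *\<^sub>R z (r n)" for n
    using t0[of "r n"] by (simp add: w_def scaleR_add_right)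
  ultimately have lim: "(\<lambda>n. (1 / t (r n)) *\<^sub>R z (r n)) \<longlonglongrightarrow> - e" by simp
  have "- e \<in> Z"
    by (rule closed_sequentially[OF Z(2) _ lim]) (rule subspace_scale[OF Z(1) zt(1)])
  then show False
    using e subspace_neg[OF Z(1), of "- e"] by simp
qed

text \<open>For \<open>e\<close> outside \<open>Z\<close> the coefficients of a convergent sequence
  are Cauchy by the preceding lemma. Their limit splits off, and the components in \<open>Z\<close>
  converge in \<open>Z\<close>.\<close>

lemma closed_add_line:
  fixes Z :: "'a::frechet_space set"
  assumes Z: "subspace Z" "closed Z"
  shows "closed {z + t *\<^sub>R e | z t. z \<in> Z}"
proof (cases "e \<in> Z")
  case True
  have "{z + t *\<^sub>R e | z t. z \<in> Z} = Z"
  proof (intro subset_antisym subsetI)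
    fix y assume "y \<in> Z"
    then show "y \<in> {z + t *\<^sub>R e | z t. z \<in> Z}"
      by (intro CollectI exI[of _ y] exI[of _ 0]) simp
  qed (use True Z(1) in \<open>auto intro: subspace_add subspace_scale\<close>)
  then show ?thesis using Z(2) by simp
next
  case False
  show ?thesis
    unfolding closed_sequential_limits
  proof (intro allI impI)
    fix y l assume y: "(\<forall>n. y n \<in> {z + t *\<^sub>R e | z t. z \<in> Z}) \<and> y \<longlonglongrightarrow> l"
    then have "\<forall>n. \<exists>z t. z \<in> Z \<and> y n = z + t *\<^sub>R e" by blast
    then obtain z t where zt: "\<And>n. z n \<in> Z" "\<And>n. y n = z n + t n *\<^sub>R e" by metis
    have "Cauchy t"
    proof (rule metric_CauchyI)
      fix \<epsilon> :: real assume "\<epsilon> > 0"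
      then obtain d where d: "d > 0" "\<And>z t. z \<in> Z \<Longrightarrow> dist (z + t *\<^sub>R e) 0 < d \<Longrightarrow> \<bar>t\<bar> < \<epsilon>"
        using closed_subspace_coefficient_small[OF Z False] by blast
      have "Cauchy y" using y LIMSEQ_imp_Cauchy by blast
      then obtain n0 where n0: "\<And>m n. m \<ge> n0 \<Longrightarrow> n \<ge> n0 \<Longrightarrow> dist (y m) (y n) < d"
        using d(1) metric_CauchyD by blast
      have "dist (t m) (t n) < \<epsilon>" if "m \<ge> n0" "n \<ge> n0" for m n
      proof -
        have "(z m - z n) + (t m - t n) *\<^sub>R e = y m - y n"
          unfolding zt(2) by (simp add: algebra_simps)
        then have "dist ((z m - z n) + (t m - t n) *\<^sub>R e) 0 < d"
          using n0[OF that] by (simp add: dist_diff_0)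
        then show ?thesis
          using d(2)[of "z m - z n"] subspace_diff[OF Z(1)] zt(1) by (simp add: dist_real_def)
      qed
      then show "\<exists>M. \<forall>m\<ge>M. \<forall>n\<ge>M. dist (t m) (t n) < \<epsilon>" by blast
    qed
    then obtain a where a: "t \<longlonglongrightarrow> a"
      using Cauchy_convergent_iff convergent_def by blast
    have "(\<lambda>n. y n - t n *\<^sub>R e) \<longlonglongrightarrow> l - a *\<^sub>R e"
      using y a by (intro tendsto_diff tendsto_scaleR_tvs tendsto_const) auto
    then have "z \<longlonglongrightarrow> l - a *\<^sub>R e"
      by (simp add: zt(2))
    then have "l - a *\<^sub>R e \<in> Z"
      by (rule closed_sequentially[OF Z(2) zt(1)])
    then show "l \<in> {z + t *\<^sub>R e | z t. z \<in> Z}"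
      by (intro CollectI exI[of _ "l - a *\<^sub>R e"] exI[of _ a]) simp
  qed
qed

lemma closed_add_span_finite:
  fixes Z :: "'a::frechet_space set"
  assumes "finite B" "subspace Z" "closed Z"
  shows "closed {z + b | z b. z \<in> Z \<and> b \<in> span B}"
  using assms(1)
proof (induction B rule: finite_induct)
  case empty
  then show ?case using assms(3) by simp
next
  case (insert e B)
  let ?S = "{z + b | z b. z \<in> Z \<and> b \<in> span B}"
  have "{z + b | z b. z \<in> Z \<and> b \<in> span (insert e B)} = {s + t *\<^sub>R e | s t. s \<in> ?S}"
  proof (intro subset_antisym subsetI)
    fix y assume "y \<in> {z + b | z b. z \<in> Z \<and> b \<in> span (insert e B)}"
    then obtain z b k where "y = z + b" "z \<in> Z" "b - k *\<^sub>R e \<in> span B"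
      unfolding span_insert by blast
    then show "y \<in> {s + t *\<^sub>R e | s t. s \<in> ?S}"
      by (intro CollectI exI[of _ "z + (b - k *\<^sub>R e)"] exI[of _ k]) auto
  next
    fix y assume "y \<in> {s + t *\<^sub>R e | s t. s \<in> ?S}"
    then obtain z b t where y: "y = z + b + t *\<^sub>R e" "z \<in> Z" "b \<in> span B" by blast
    then have "b + t *\<^sub>R e \<in> span (insert e B)"
      unfolding span_insert by (intro CollectI exI[of _ t]) simp
    then show "y \<in> {z + b | z b. z \<in> Z \<and> b \<in> span (insert e B)}"
      using y by (intro CollectI exI[of _ z] exI[of _ "b + t *\<^sub>R e"]) (simp add: add.assoc)
  qed
  moreover have "closed {s + t *\<^sub>R e | s t. s \<in> ?S}"
    by (rule closed_add_line[OF subspace_sums[OF assms(2) subspace_span] insert.IH])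
  ultimately show ?case by simp
qed

text \<open>Every \<open>y\<close> is \<open>(y - f y e) + f y e\<close> with the first summand in
  the kernel, so \<open>f\<close> reads off the coefficient of \<open>e\<close>, which is small near
  \<open>0\<close>.\<close>

lemma cont_linear_closed_kernel:
  fixes f :: "'a::frechet_space \<Rightarrow> real"
  assumes f: "linear f" and closed: "closed {y. f y = 0}" and e: "f e = 1"
  shows "f \<in> cont_linear"
proof -
  have "continuous_on UNIV f"
    unfolding continuous_on_iff
  proof (intro ballI allI impI)
    fix y and \<epsilon> :: real assume \<epsilon>: "\<epsilon> > 0"
    obtain d where d: "d > 0" "\<And>z t. f z = 0 \<Longrightarrow> dist (z + t *\<^sub>R e) 0 < d \<Longrightarrow> \<bar>t\<bar> < \<epsilon>"
      using closed_subspace_coefficient_small[OF linear_subspace_kernel[OF f] closed _ \<epsilon>, of e] e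
      by auto
    have "dist (f y') (f y) < \<epsilon>" if "dist y' y < d" for y'
    proof -
      have "\<bar>f (y' - y)\<bar> < \<epsilon>"
        by (rule d(2)[of "(y' - y) - f (y' - y) *\<^sub>R e"])
          (use that e in \<open>simp_all add: linear_diff[OF f] linear_scale[OF f] dist_diff_0\<close>)
      then show ?thesis by (simp add: linear_diff[OF f] dist_real_def)
    qed
    then show "\<exists>d>0. \<forall>y'\<in>UNIV. dist y' y < d \<longrightarrow> dist (f y') (f y) < \<epsilon>"
      using d(1) by blast
  qed
  then show ?thesis using f unfolding cont_linear_def by blast
qed

section \<open>Dual systems and finite-codimensional complements\<close>

text \<open>\<open>\<beta> i\<close> is the \<open>i\<close>-th coordinate of the projection onto
  \<open>H\<^sub>0\<close> along \<open>G\<^sub>0\<close>. This is constructed algebraically;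
  continuity comes from closedness of the kernel.\<close>

lemma complement_finite_dim_obtain_dual:
  fixes G\<^sub>0 H\<^sub>0 :: "'a::frechet_space set"
  assumes G: "subspace G\<^sub>0" "closed G\<^sub>0" and H: "subspace H\<^sub>0" "has_finite_dim H\<^sub>0 m"
    and sum: "{a + b |a b. a \<in> G\<^sub>0 \<and> b \<in> H\<^sub>0} = UNIV" and int: "G\<^sub>0 \<inter> H\<^sub>0 = {0}"
  obtains \<beta> :: "nat \<Rightarrow> 'a \<Rightarrow> real" and b :: "nat \<Rightarrow> 'a" where
    "\<And>i. i < m \<Longrightarrow> \<beta> i \<in> cont_linear"
    "\<And>i j. i < m \<Longrightarrow> j < m \<Longrightarrow> \<beta> i (b j) = (if i = j then 1 else 0)"
    "G\<^sub>0 = {y. \<forall>i<m. \<beta> i y = 0}"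
proof -
  obtain C where C: "finite C" "span C = H\<^sub>0" "dim H\<^sub>0 = m"
    using H(2) unfolding has_finite_dim_def by blast
  obtain B where B: "B \<subseteq> H\<^sub>0" "independent B" "H\<^sub>0 \<subseteq> span B" "card B = m"
    using basis_exists[of H\<^sub>0] C(3) by blast
  have finB: "finite B"
    using independent_span_bound[OF C(1) B(2)] B(1) C(2) by blast
  have spanB: "span B = H\<^sub>0"
    using B(1,3) span_minimal[OF B(1) H(1)] by blast
  obtain b where b: "bij_betw b {..<m} B"
    using ex_bij_betw_nat_finite[OF finB] B(4) by (auto simp: atLeast0LessThan)
  have bB: "b i \<in> B" if "i < m" for i
    using b that by (auto simp: bij_betw_def)
  have b_inj: "b i = b j \<longleftrightarrow> i = j" if "i < m" "j < m" for i j
    using b that by (auto simp: bij_betw_def inj_on_def)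
  have "\<exists>f. linear f \<and> (\<forall>y\<in>B. f y = (if y = b i then 1 else 0 :: real))" for i
    by (rule linear_independent_extend[OF B(2)])
  then obtain \<mu> where \<mu>: "\<And>i. linear (\<mu> i)" "\<And>i y. y \<in> B \<Longrightarrow> \<mu> i y = (if y = b i then 1 else 0 :: real)"
    by metis
  have \<mu>b: "\<mu> i (b j) = (if i = j then 1 else 0)" if "i < m" "j < m" for i j
    using \<mu>(2)[OF bB[OF that(2)], of i] b_inj that by auto
  have expand: "h = (\<Sum>i<m. \<mu> i h *\<^sub>R b i)" if h: "h \<in> H\<^sub>0" for h
  proof (rule linear_eq_on_span[where f = "\<lambda>h. h" and B = B])
    show "linear (\<lambda>h. \<Sum>i<m. \<mu> i h *\<^sub>R b i)"
      by (intro linear_compose_sum ballI linearI)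
        (simp_all add: linear_add[OF \<mu>(1)] linear_scale[OF \<mu>(1)] scaleR_add_left)
    fix y assume "y \<in> B"
    then obtain j where j: "j < m" "y = b j" using b by (auto simp: bij_betw_def)
    have "(\<Sum>i<m. \<mu> i y *\<^sub>R b i) = (\<Sum>i<m. if i = j then b i else 0)"
      by (rule sum.cong) (use j \<mu>b in auto)
    then show "y = (\<Sum>i<m. \<mu> i y *\<^sub>R b i)" using j by simp
  qed (use h spanB linear_id in \<open>auto simp: id_def\<close>)
  have "\<forall>y. \<exists>h. h \<in> H\<^sub>0 \<and> y - h \<in> G\<^sub>0"
  proof
    fix y
    have "y \<in> {a + b |a b. a \<in> G\<^sub>0 \<and> b \<in> H\<^sub>0}" using sum by simp
    then show "\<exists>h. h \<in> H\<^sub>0 \<and> y - h \<in> G\<^sub>0" by force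
  qed
  \<comment> \<open>\<open>p y\<close> is the \<open>H\<^sub>0\<close>-component of
    \<open>y\<close>; its uniqueness, from the trivial intersection, makes \<open>p\<close>
    linear.\<close>
  then obtain p where p: "\<And>y. p y \<in> H\<^sub>0" "\<And>y. y - p y \<in> G\<^sub>0" by metis
  have p_eq: "p y = h" if "h \<in> H\<^sub>0" "y - h \<in> G\<^sub>0" for y h
  proof -
    have "h - p y \<in> G\<^sub>0"
      using subspace_diff[OF G(1) p(2)[of y] that(2)] by simp
    moreover have "h - p y \<in> H\<^sub>0" by (rule subspace_diff[OF H(1) that(1) p(1)])
    ultimately have "h - p y = 0" using int by blast
    then show ?thesis by simp
  qed
  have p_lin: "linear p"
  proof (rule linearI)
    fix y z
    show "p (y + z) = p y + p z"
      using subspace_add[OF G(1) p(2)[of y] p(2)[of z]]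
      by (intro p_eq subspace_add[OF H(1)] p(1)) (simp add: algebra_simps)
  next
    fix r y
    show "p (r *\<^sub>R y) = r *\<^sub>R p y"
      using subspace_scale[OF G(1) p(2)[of y], of r]
      by (intro p_eq subspace_scale[OF H(1)] p(1)) (simp add: scaleR_diff_right)
  qed
  have pb: "p (b i) = b i" if "i < m" for i
    by (rule p_eq) (use B(1) bB[OF that] subspace_0[OF G(1)] in auto)
  define \<beta> where "\<beta> = (\<lambda>i y. \<mu> i (p y))"
  have dual: "\<beta> i (b j) = (if i = j then 1 else 0)" if "i < m" "j < m" for i j
    unfolding \<beta>_def using pb \<mu>b that by simp
  show ?thesis
  proof (rule that[of \<beta> b, OF _ dual])
    fix i assume i: "i < m"
    have lin: "linear (\<beta> i)"
      unfolding \<beta>_def using linear_compose[OF p_lin \<mu>(1)] by (simp add: comp_def)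
    \<comment> \<open>The kernel is \<open>G\<^sub>0\<close> enlarged by the span of the other basis
      vectors, and a closed subspace plus a finite-dimensional one is closed.\<close>
    have "{y. \<beta> i y = 0} = {z + h | z h. z \<in> G\<^sub>0 \<and> h \<in> span (B - {b i})}"
    proof (intro subset_antisym subsetI)
      fix y assume "y \<in> {y. \<beta> i y = 0}"
      then have y: "\<mu> i (p y) = 0" unfolding \<beta>_def by simp
      have "(\<Sum>j<m. \<mu> j (p y) *\<^sub>R b j) \<in> span (B - {b i})"
      proof (rule span_sum)
        fix j assume "j \<in> {..<m}"
        then show "\<mu> j (p y) *\<^sub>R b j \<in> span (B - {b i})"
          using y bB[of j] b_inj[OF _ i, of j]
          by (cases "j = i") (auto intro: span_scale span_base span_zero)
      qed
      then have "p y \<in> span (B - {b i})" using expand[OF p(1)] by metis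
      then show "y \<in> {z + h | z h. z \<in> G\<^sub>0 \<and> h \<in> span (B - {b i})}"
        using p(2)[of y] by (intro CollectI exI[of _ "y - p y"] exI[of _ "p y"]) simp
    next
      fix y assume "y \<in> {z + h | z h. z \<in> G\<^sub>0 \<and> h \<in> span (B - {b i})}"
      then obtain z h where zh: "y = z + h" "z \<in> G\<^sub>0" "h \<in> span (B - {b i})" by blast
      have "h \<in> H\<^sub>0" using zh(3) span_mono[of "B - {b i}" B] spanB by blast
      then have "p y = h" using zh by (intro p_eq) auto
      moreover have "\<mu> i h = 0"
        by (rule linear_eq_0_on_span[OF \<mu>(1) _ zh(3)]) (simp add: \<mu>(2))
      ultimately show "y \<in> {y. \<beta> i y = 0}" unfolding \<beta>_def by simp
    qed
    then have "closed {y. \<beta> i y = 0}"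
      using closed_add_span_finite[OF _ G, of "B - {b i}"] finB by simp
    then show "\<beta> i \<in> cont_linear"
      by (rule cont_linear_closed_kernel[OF lin _, of "b i"]) (use dual[OF i i] in simp)
  next
    show "G\<^sub>0 = {y. \<forall>i<m. \<beta> i y = 0}"
    proof (intro subset_antisym subsetI)
      fix y assume "y \<in> G\<^sub>0"
      then have "p y = 0" by (intro p_eq subspace_0[OF H(1)]) simp
      then show "y \<in> {y. \<forall>i<m. \<beta> i y = 0}" unfolding \<beta>_def using linear_0[OF \<mu>(1)] by simp
    next
      fix y assume "y \<in> {y. \<forall>i<m. \<beta> i y = 0}"
      then have "(\<Sum>i<m. \<mu> i (p y) *\<^sub>R b i) = 0" unfolding \<beta>_def by simp
      then have "p y = 0" using expand[OF p(1)] by metis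
      then show "y \<in> G\<^sub>0" using p(2)[of y] by simp
    qed
  qed
qed

text \<open>The sum of the \<open>\<beta> i y e i\<close> defines a continuous projection with
  kernel \<open>G\<^sub>0\<close> and range \<open>H\<^sub>0\<close>; the range is closed as the set
  of its fixed points.\<close>

lemma dual_system_complement:
  fixes \<beta> :: "nat \<Rightarrow> 'a::frechet_space \<Rightarrow> real" and e :: "nat \<Rightarrow> 'a"
  assumes \<beta>: "\<And>i. i < m \<Longrightarrow> \<beta> i \<in> cont_linear"
    and dual: "\<And>i j. i < m \<Longrightarrow> j < m \<Longrightarrow> \<beta> i (e j) = (if i = j then 1 else 0)"
  defines "G\<^sub>0 \<equiv> {y. \<forall>i<m. \<beta> i y = 0}" and "H\<^sub>0 \<equiv> span (e ` {..<m})"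
  shows "subspace G\<^sub>0" "closed G\<^sub>0" "subspace H\<^sub>0" "closed H\<^sub>0"
    "{a + b |a b. a \<in> G\<^sub>0 \<and> b \<in> H\<^sub>0} = UNIV" "G\<^sub>0 \<inter> H\<^sub>0 = {0}" "has_finite_dim H\<^sub>0 m"
proof -
  have lin: "linear (\<beta> i)" and cont: "continuous_on UNIV (\<beta> i)" if "i < m" for i
    using \<beta>[OF that] unfolding cont_linear_def by auto
  define p where "p = (\<lambda>y. \<Sum>i<m. \<beta> i y *\<^sub>R e i)"
  have pH: "p y \<in> H\<^sub>0" for y
    unfolding p_def H\<^sub>0_def by (intro span_sum span_scale span_base) auto
  have pe: "p (e j) = e j" if "j < m" for j
  proof -
    have "p (e j) = (\<Sum>i<m. if i = j then e i else 0)"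
      unfolding p_def by (rule sum.cong) (use dual that in auto)
    then show ?thesis using that by simp
  qed
  have p_lin: "linear p"
    unfolding p_def
    by (intro linear_compose_sum ballI linearI)
      (simp_all add: linear_add[OF lin] linear_scale[OF lin] scaleR_add_left)
  have p_id: "p y = y" if "y \<in> H\<^sub>0" for y
    by (rule linear_eq_on_span[OF p_lin, where g = "\<lambda>y. y" and B = "e ` {..<m}"])
      (use that pe linear_id in \<open>auto simp: id_def H\<^sub>0_def\<close>)
  have \<beta>p: "\<beta> i (p y) = \<beta> i y" if "i < m" for i y
  proof -
    have "\<beta> i (p y) = (\<Sum>j<m. if i = j then \<beta> j y else 0)"
      unfolding p_def linear_sum[OF lin[OF that]]
      by (rule sum.cong) (use dual that in \<open>auto simp: linear_scale[OF lin[OF that]]\<close>)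
    then show ?thesis using that by simp
  qed
  show "subspace G\<^sub>0"
    unfolding G\<^sub>0_def subspace_def
    by (auto simp: linear_0[OF lin] linear_add[OF lin] linear_scale[OF lin])
  have "G\<^sub>0 = (\<Inter>i\<in>{..<m}. {y. \<beta> i y = 0})" unfolding G\<^sub>0_def by auto
  then show "closed G\<^sub>0"
    using cont by (auto intro!: closed_INT closed_Collect_eq continuous_on_const)
  show "subspace H\<^sub>0" unfolding H\<^sub>0_def by (rule subspace_span)
  have "H\<^sub>0 = {y. p y = y}" using p_id pH by (metis (mono_tags, lifting) Collect_cong Collect_mem_eq)
  moreover have "continuous_on UNIV p"
    unfolding p_def using cont by (intro continuous_on_sum continuous_on_scaleR_tvs continuous_on_const) auto
  ultimately show "closed H\<^sub>0" by (auto intro: closed_Collect_eq continuous_on_id)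
  have "y \<in> {a + b |a b. a \<in> G\<^sub>0 \<and> b \<in> H\<^sub>0}" for y
  proof -
    have "y - p y \<in> G\<^sub>0"
      unfolding G\<^sub>0_def using \<beta>p by (simp add: linear_diff[OF lin])
    then show ?thesis
      using pH by (intro CollectI exI[of _ "y - p y"] exI[of _ "p y"]) simp
  qed
  then show "{a + b |a b. a \<in> G\<^sub>0 \<and> b \<in> H\<^sub>0} = UNIV" by blast
  have "y = 0" if "y \<in> G\<^sub>0" "y \<in> H\<^sub>0" for y
    using p_id[OF that(2)] that(1) unfolding G\<^sub>0_def p_def by simp
  then show "G\<^sub>0 \<inter> H\<^sub>0 = {0}"
    using subspace_0[OF \<open>subspace G\<^sub>0\<close>] subspace_0[OF \<open>subspace H\<^sub>0\<close>] by blast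
  have inj: "inj_on e {..<m}"
    using dual by (intro inj_onI) (metis lessThan_iff zero_neq_one)
  have "independent (e ` {..<m})"
  proof (rule independent_if_scalars_zero)
    fix f y assume f: "(\<Sum>x\<in>e ` {..<m}. f x *\<^sub>R x) = 0" and "y \<in> e ` {..<m}"
    then obtain j where j: "j < m" "y = e j" by blast
    have "0 = \<beta> j (\<Sum>i<m. f (e i) *\<^sub>R e i)"
      using f by (simp add: sum.reindex[OF inj] linear_0[OF lin[OF j(1)]])
    also have "\<dots> = (\<Sum>i<m. if i = j then f (e i) else 0)"
      unfolding linear_sum[OF lin[OF j(1)]]
      by (rule sum.cong) (use dual j in \<open>auto simp: linear_scale[OF lin[OF j(1)]]\<close>)
    finally show "f y = 0" using j by simp
  qed simp
  then have "dim H\<^sub>0 = m"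
    unfolding H\<^sub>0_def by (simp add: dim_eq_card_independent card_image[OF inj])
  then show "has_finite_dim H\<^sub>0 m"
    unfolding has_finite_dim_def H\<^sub>0_def by blast
qed


section \<open>Tangent spaces and preimages of submanifolds\<close>

lemma has_dir_deriv_tendsto:
  assumes "has_dir_deriv f u v d"
  shows "((\<lambda>t. f (u + t *\<^sub>R v)) \<longlongrightarrow> f u) (at 0)"
proof (rule Lim_transform_eventually)
  have "((\<lambda>t. f u + t *\<^sub>R ((1 / t) *\<^sub>R (f (u + t *\<^sub>R v) - f u))) \<longlongrightarrow> f u + 0 *\<^sub>R d) (at 0)"
    using assms unfolding has_dir_deriv_def
    by (intro tendsto_add tendsto_const tendsto_scaleR_tvs tendsto_ident_at)
  then show "((\<lambda>t. f u + t *\<^sub>R ((1 / t) *\<^sub>R (f (u + t *\<^sub>R v) - f u))) \<longlongrightarrow> f u) (at 0)"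
    by simp
  show "\<forall>\<^sub>F t in at 0. f u + t *\<^sub>R ((1 / t) *\<^sub>R (f (u + t *\<^sub>R v) - f u)) = f (u + t *\<^sub>R v)"
    using eventually_neq_at_within[of 0 0 UNIV] by eventually_elim simp
qed

text \<open>The chart sends a curve in \<open>M\<close> into \<open>G\<^sub>0\<close> near
  \<open>0\<close>, so its difference quotients there, and by closedness their limit, lie in
  \<open>G\<^sub>0\<close>. Conversely, a line in \<open>G\<^sub>0\<close> through
  \<open>K p\<close> is pulled back by \<open>L\<close> to a curve in \<open>M\<close> with the
  prescribed velocity.\<close>

lemma tangent_space_chart:
  fixes K :: "'a::frechet_space \<Rightarrow> 'b::frechet_space"
  assumes pair: "C1F_inverse_pair V W K K' L L'" and KM: "K ` (M \<inter> V) = W \<inter> G\<^sub>0"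
    and G: "subspace G\<^sub>0" "closed G\<^sub>0" and p: "p \<in> M" "p \<in> V"
  shows "tangent_space M p = K' p -` G\<^sub>0"
proof (intro subset_antisym subsetI)
  note P = C1F_inverse_pairD[OF pair]
  fix w assume "w \<in> tangent_space M p"
  then obtain I :: "real set" and c :: "real \<Rightarrow> 'a" and c' where I: "open I" "0 \<in> I" and c: "\<And>t. t \<in> I \<Longrightarrow> has_dir_deriv c t 1 (c' t)"
    "c 0 = p" "c ` I \<subseteq> M" and w: "c' 0 = w"
    unfolding tangent_space_def by blast
  have c0: "has_dir_deriv c 0 1 w" using c(1)[OF I(2)] w by simp
  have "has_dir_deriv (\<lambda>t. K (c t)) 0 1 (K' p w)"
    using has_dir_deriv_compose[OF P(1) c0] p(2) c(2) by simp
  then have lim: "((\<lambda>t. (1 / t) *\<^sub>R (K (c t) - K p)) \<longlongrightarrow> K' p w) (at 0)"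
    unfolding has_dir_deriv_def using c(2) by simp
  have "(c \<longlongrightarrow> p) (at 0)"
    using has_dir_deriv_tendsto[OF c0] c(2) by simp
  then have "\<forall>\<^sub>F t in at 0. c t \<in> V"
    using has_C1F_derivD(1)[OF P(1)] p(2) by (auto dest: topological_tendstoD)
  moreover have "\<forall>\<^sub>F t in at 0. t \<in> I"
    using I by (rule eventually_at_in_open')
  ultimately have "\<forall>\<^sub>F t in at 0. (1 / t) *\<^sub>R (K (c t) - K p) \<in> G\<^sub>0"
  proof eventually_elim
    case (elim t)
    then have "K (c t) \<in> G\<^sub>0" "K p \<in> G\<^sub>0" using c(3) KM p by blast+
    then show ?case using G(1) by (intro subspace_scale subspace_diff)
  qed
  then have "K' p w \<in> G\<^sub>0"
    by (rule Lim_in_closed_set[OF G(2) _ _ lim]) simp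
  then show "w \<in> K' p -` G\<^sub>0" by simp
next
  note P = C1F_inverse_pairD[OF pair]
  fix w assume "w \<in> K' p -` G\<^sub>0"
  define h where "h = K' p w"
  have h: "h \<in> G\<^sub>0" using \<open>w \<in> K' p -` G\<^sub>0\<close> unfolding h_def by simp
  have line: "continuous_on S (\<lambda>t::real. K p + t *\<^sub>R h)" for S
    by (intro continuous_on_add continuous_on_const continuous_on_scaleR_tvs continuous_on_id)
  have "open ((\<lambda>t::real. K p + t *\<^sub>R h) -` W)"
    by (rule open_vimage[OF has_C1F_derivD(1)[OF P(2)] line])
  moreover have "0 \<in> (\<lambda>t::real. K p + t *\<^sub>R h) -` W" using P(3)[OF p(2)] by simp
  ultimately obtain d where d: "d > 0" "ball 0 d \<subseteq> (\<lambda>t::real. K p + t *\<^sub>R h) -` W"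
    using open_contains_ball by blast
  define c where "c = (\<lambda>t. L (K p + t *\<^sub>R h))"
  define c' where "c' = (\<lambda>t. L' (K p + t *\<^sub>R h) h)"
  have W: "K p + t *\<^sub>R h \<in> W" if "t \<in> ball 0 d" for t using d(2) that by auto
  have KpG: "K p \<in> G\<^sub>0" using KM p by blast
  have "has_dir_deriv c t 1 (c' t)" if "t \<in> ball 0 d" for t
    unfolding c_def c'_def
    by (rule has_dir_deriv_along_line[OF has_C1F_derivD(6)[OF P(2) W[OF that]]])
  moreover have "continuous_on (ball 0 d) c'"
    unfolding c'_def
    by (rule continuous_on_compose2[OF has_C1F_deriv_slice_continuous[OF P(2)] line]) (use W in auto)
  moreover have "c t \<in> M" if t: "t \<in> ball 0 d" for t
  proof -
    have "K p + t *\<^sub>R h \<in> W \<inter> G\<^sub>0"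
      using W[OF t] KpG h G(1) by (auto intro: subspace_add subspace_scale)
    then obtain m where "m \<in> M \<inter> V" "K p + t *\<^sub>R h = K m" using KM by blast
    then show ?thesis unfolding c_def using P(4)[of m] by simp
  qed
  moreover have "c 0 = p" "c' 0 = w"
    unfolding c_def c'_def h_def using P(4)[OF p(2)] C1F_inverse_pair_deriv[OF pair p(2)] by auto
  moreover have "is_interval (ball 0 d :: real set)"
    by (simp add: is_interval_convex_1)
  ultimately show "w \<in> tangent_space M p"
    unfolding tangent_space_def using d(1)
    by (intro CollectI exI[of _ "ball 0 d"] exI[of _ c] exI[of _ c']) auto
qed

lemma transversal_preimage:
  fixes g :: "'f::frechet_space \<Rightarrow> 'g::frechet_space"
  assumes g: "has_C1F_deriv U g g'" and x: "x \<in> U"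
    and M: "C1F_submanifold_codim M m" and gx: "g x \<in> M"
    and trans: "UNIV = {a + b |a b. a \<in> range (g' x) \<and> b \<in> tangent_space M (g x)}"
  shows "\<exists>V. open V \<and> x \<in> V \<and> V \<subseteq> U \<and>
    C1F_submanifold_codim (V \<inter> {u \<in> U. g u \<in> M}) m \<and>
    tangent_space ({u \<in> U. g u \<in> M} \<inter> V) x = g' x -` tangent_space M (g x)"
proof -
  obtain G\<^sub>0 H\<^sub>0 where G: "subspace G\<^sub>0" "closed G\<^sub>0" and H: "subspace H\<^sub>0" "has_finite_dim H\<^sub>0 m"
    and sum: "{a + b |a b. a \<in> G\<^sub>0 \<and> b \<in> H\<^sub>0} = UNIV" and int: "G\<^sub>0 \<inter> H\<^sub>0 = {0}"
    and over: "C1F_submanifold_over G\<^sub>0 M"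
    using M unfolding C1F_submanifold_codim_def by blast
  obtain \<beta> b where \<beta>: "\<And>i. i < m \<Longrightarrow> \<beta> i \<in> (cont_linear :: ('g \<Rightarrow> real) set)"
    "\<And>i j. i < m \<Longrightarrow> j < m \<Longrightarrow> \<beta> i (b j) = (if i = j then 1 else 0)"
    and G_eq: "G\<^sub>0 = {y. \<forall>i<m. \<beta> i y = 0}"
    using complement_finite_dim_obtain_dual[OF G H sum int] by blast
  obtain V1 W1 K where V1: "open V1" "g x \<in> V1" "C1F_diffeo V1 W1 K" and KM: "K ` (M \<inter> V1) = W1 \<inter> G\<^sub>0"
    using over gx unfolding C1F_submanifold_over_def by blast
  obtain K' L L' where pair: "C1F_inverse_pair V1 W1 K K' L L'"
    using C1F_diffeo_imp_inverse_pair[OF V1(3)] by blast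
  note P = C1F_inverse_pairD[OF pair]
  have T: "tangent_space M (g x) = K' (g x) -` G\<^sub>0"
    by (rule tangent_space_chart[OF pair KM G gx V1(2)])
  define U1 where "U1 = U \<inter> g -` V1"
  have "open U1"
    unfolding U1_def by (intro continuous_open_preimage has_C1F_derivD(1,2)[OF g] V1(1))
  then have g1: "has_C1F_deriv U1 g g'"
    by (rule has_C1F_deriv_subset[OF g]) (simp add: U1_def)
  have x1: "x \<in> U1" using x V1(2) unfolding U1_def by simp
  define \<phi> where "\<phi> = (\<lambda>i u. \<beta> i (K (g u)))"
  define \<phi>' where "\<phi>' = (\<lambda>i u v. \<beta> i (K' (g u) (g' u v)))"
  have \<phi>: "has_C1F_deriv U1 (\<phi> i) (\<phi>' i)" if "i < m" for i
    unfolding \<phi>_def \<phi>'_def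
    by (rule has_C1F_deriv_compose[OF g1 has_C1F_deriv_compose[OF P(1)
            has_C1F_deriv_linear[OF open_UNIV \<beta>(1)[OF that]]]]) (auto simp: U1_def)
  have "\<exists>e. \<forall>i<m. \<phi>' i x e = (if i = j then 1 else 0)" if j: "j < m" for j
  proof -
    \<comment> \<open>The vector that \<open>K' (g x)\<close> maps to \<open>b j\<close> is split by
      transversality. Its tangential part is sent into \<open>G\<^sub>0\<close> and killed by every
      \<open>\<beta> i\<close>, so \<open>a\<close> alone has the required dual values.\<close>
    obtain a \<tau> where a: "L' (K (g x)) (b j) = g' x a + \<tau>" "\<tau> \<in> tangent_space M (g x)"
      using trans by blast
    have lin: "linear (K' (g x))" by (rule has_C1F_derivD(4)[OF P(1) V1(2)])
    have "K' (g x) (L' (K (g x)) (b j)) = b j"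
      using C1F_inverse_pair_deriv[OF C1F_inverse_pair_sym[OF pair] P(3)[OF V1(2)], of "b j"]
        P(4)[OF V1(2)] by simp
    then have b: "b j = K' (g x) (g' x a) + K' (g x) \<tau>"
      using a(1) linear_add[OF lin] by simp
    have "\<phi>' i x a = (if i = j then 1 else 0)" if i: "i < m" for i
    proof -
      have "linear (\<beta> i)" using \<beta>(1)[OF i] unfolding cont_linear_def by blast
      moreover have "\<beta> i (K' (g x) \<tau>) = 0"
        using a(2) i unfolding T G_eq by simp
      ultimately have "\<beta> i (b j) = \<phi>' i x a"
        unfolding \<phi>'_def b by (simp add: linear_add)
      then show ?thesis using \<beta>(2)[OF i j] by simp
    qed
    then show ?thesis by blast
  qed
  then obtain e where e: "\<And>i j. i < m \<Longrightarrow> j < m \<Longrightarrow> \<phi>' i x (e j) = (if i = j then 1 else 0)"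
    by metis
  obtain V W \<Psi> \<Psi>' Q Q' where V: "x \<in> V" "V \<subseteq> U1" and pair2: "C1F_inverse_pair V W \<Psi> \<Psi>' Q Q'"
    and id: "\<And>v. \<Psi>' x v = v" and str: "\<And>i u. i < m \<Longrightarrow> u \<in> V \<Longrightarrow> \<phi>' i x (\<Psi> u) = \<phi> i u"
    using straighten_scalar_functions[of m U1 \<phi> \<phi>' x e, OF \<phi> \<open>open U1\<close> x1 e] by blast
  note R = C1F_inverse_pairD[OF pair2]
  let ?N = "V \<inter> {u \<in> U. g u \<in> M}"
  \<comment> \<open>The model space of the preimage: the common kernel of the derivatives of the
    \<open>\<phi> i\<close> at \<open>x\<close>. The span of the \<open>e j\<close> will be its
    complement.\<close>
  define G1 where "G1 = {y. \<forall>i<m. \<phi>' i x y = 0}"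
  have level: "g u \<in> M \<longleftrightarrow> \<Psi> u \<in> G1" if u: "u \<in> V" for u
  proof -
    have "g u \<in> V1" using u V(2) unfolding U1_def by blast
    have "g u \<in> M \<longleftrightarrow> K (g u) \<in> G\<^sub>0"
    proof
      assume "g u \<in> M"
      then show "K (g u) \<in> G\<^sub>0" using KM \<open>g u \<in> V1\<close> by blast
    next
      assume "K (g u) \<in> G\<^sub>0"
      then obtain y where "y \<in> M \<inter> V1" "K (g u) = K y"
        using KM P(3)[OF \<open>g u \<in> V1\<close>] by blast
      then show "g u \<in> M" using P(4)[of y] P(4)[OF \<open>g u \<in> V1\<close>] by simp
    qed
    also have "\<dots> \<longleftrightarrow> \<Psi> u \<in> G1"
      unfolding G_eq G1_def using str[OF _ u] by (simp add: \<phi>_def)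
    finally show ?thesis .
  qed
  have image: "\<Psi> ` (?N \<inter> V) = W \<inter> G1"
  proof (intro subset_antisym subsetI)
    fix w assume "w \<in> \<Psi> ` (?N \<inter> V)"
    then show "w \<in> W \<inter> G1" using level R(3) by auto
  next
    fix w assume w: "w \<in> W \<inter> G1"
    then have "Q w \<in> V" "\<Psi> (Q w) = w" using R(5,6) by auto
    then show "w \<in> \<Psi> ` (?N \<inter> V)"
      using level[of "Q w"] w V(2) unfolding U1_def by (intro image_eqI[of _ _ "Q w"]) auto
  qed
  have compl: "subspace G1" "closed G1" "subspace (span (e ` {..<m}))" "closed (span (e ` {..<m}))"
      "{a + b |a b. a \<in> G1 \<and> b \<in> span (e ` {..<m})} = UNIV"
      "G1 \<inter> span (e ` {..<m}) = {0}" "has_finite_dim (span (e ` {..<m})) m"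
    unfolding G1_def
    by (rule dual_system_complement[of m "\<lambda>i. \<phi>' i x" e];
        use has_C1F_derivD(3)[OF \<phi> x1] e in blast)+
  have openV: "open V" by (rule has_C1F_derivD(1)[OF R(1)])
  \<comment> \<open>The single chart \<open>\<Psi>\<close> on \<open>V\<close> serves every point of
    \<open>?N\<close>.\<close>
  have "C1F_submanifold_over G1 ?N"
    unfolding C1F_submanifold_over_def
    using openV C1F_inverse_pair_imp_diffeo[OF pair2] image by blast
  then have codim: "C1F_submanifold_codim ?N m"
    unfolding C1F_submanifold_codim_def using compl by blast
  have "x \<in> ?N" using V(1) x gx by blast
  then have "tangent_space ?N x = \<Psi>' x -` G1"
    by (rule tangent_space_chart[OF pair2 image compl(1,2) _ V(1)])
  \<comment> \<open>Since \<open>\<Psi>' x\<close> is the identity, the tangent space is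
    \<open>G1\<close> itself, the set of \<open>v\<close> for which \<open>K' (g x) (g' x v)\<close>
    lies in \<open>G\<^sub>0\<close>.\<close>
  also have "\<dots> = g' x -` tangent_space M (g x)"
    unfolding T G_eq G1_def \<phi>'_def by (auto simp: id)
  finally have "tangent_space ({u \<in> U. g u \<in> M} \<inter> V) x = g' x -` tangent_space M (g x)"
    by (simp add: Int_commute)
  then show ?thesis
    using openV V codim unfolding U1_def by blast
qed

section \<open>The case of a single point\<close>

lemma C1F_inverse_pair_translation:
  "C1F_inverse_pair UNIV UNIV (\<lambda>y. y + - p) (\<lambda>_ v. v) (\<lambda>y. y + p) (\<lambda>_ v. v)"
proof -
  have "has_C1F_deriv UNIV (\<lambda>y. y + q) (\<lambda>_ v. v)" for q :: 'a
    using has_C1F_deriv_add[OF has_C1F_deriv_linear[OF open_UNIV cont_linear_id]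
        has_C1F_deriv_const[OF open_UNIV, of q]] by simp
  then show ?thesis unfolding C1F_inverse_pair_def by (metis UNIV_I add.right_neutral add.assoc left_minus right_minus)
qed

text \<open>The model space is \<open>{0}\<close> with the whole space as complement, and
  translation by \<open>- p\<close> is a global chart.\<close>

lemma C1F_submanifold_codim_singleton:
  fixes p :: "'a::frechet_space"
  assumes "has_finite_dim (UNIV :: 'a set) m"
  shows "C1F_submanifold_codim {p} m"
proof -
  have "C1F_submanifold_over {0} {p}"
    unfolding C1F_submanifold_over_def
    using C1F_inverse_pair_imp_diffeo[OF C1F_inverse_pair_translation[of p]]
    by (intro ballI exI[of _ UNIV] exI[of _ "\<lambda>y. y + - p"]) auto
  then show ?thesis
    unfolding C1F_submanifold_codim_def using assms
    by (intro exI[of _ "{0}"] exI[of _ UNIV]) auto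
qed

lemma tangent_space_singleton:
  fixes p :: "'a::frechet_space"
  shows "tangent_space {p} p = {0}"
proof -
  have "tangent_space {p} p = (\<lambda>v. v) -` {0}"
    by (rule tangent_space_chart[OF C1F_inverse_pair_translation[of p]]) auto
  then show ?thesis by auto
qed

theorem proposition7p1:
  fixes g :: "'f::frechet_space \<Rightarrow> 'g::frechet_space"
    and U :: "'f set" and M :: "'g set" and x :: 'f and m :: nat
  assumes "open U" and "C1F_on U g" and "x \<in> U"
  shows
    "(C1F_submanifold_codim M m \<and> g x \<in> M \<and>
        UNIV = {a + b |a b. a \<in> range (DF g x) \<and> b \<in> tangent_space M (g x)}
      \<longrightarrow> (\<exists>V. open V \<and> x \<in> V \<and> V \<subseteq> U \<and>
            C1F_submanifold_codim (V \<inter> {u \<in> U. g u \<in> M}) m \<and>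
            tangent_space ({u \<in> U. g u \<in> M} \<inter> V) x = DF g x -` tangent_space M (g x)))
     \<and>
     (has_finite_dim (UNIV :: 'g set) m \<and> M = {g x} \<and> surj (DF g x)
      \<longrightarrow> tangent_space M (g x) = {0} \<and>
          (\<exists>V. open V \<and> x \<in> V \<and> V \<subseteq> U \<and>
            C1F_submanifold_codim (V \<inter> {u \<in> U. g u \<in> M}) m \<and>
            tangent_space ({u \<in> U. g u \<in> M} \<inter> V) x = DF g x -` {0}))"
proof (intro conjI impI)
  note main = transversal_preimage[OF C1F_on_imp_has_C1F_deriv[OF assms(2)] assms(3)]
  {
    assume "C1F_submanifold_codim M m \<and> g x \<in> M \<and>
      UNIV = {a + b |a b. a \<in> range (DF g x) \<and> b \<in> tangent_space M (g x)}"
    then show "\<exists>V. open V \<and> x \<in> V \<and> V \<subseteq> U \<and>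
      C1F_submanifold_codim (V \<inter> {u \<in> U. g u \<in> M}) m \<and>
      tangent_space ({u \<in> U. g u \<in> M} \<inter> V) x = DF g x -` tangent_space M (g x)"
      by (elim conjE) (rule main)
  next
    assume A: "has_finite_dim (UNIV :: 'g set) m \<and> M = {g x} \<and> surj (DF g x)"
    then show T: "tangent_space M (g x) = {0}"
      using tangent_space_singleton by simp
    \<comment> \<open>With tangent space \<open>{0}\<close>, transversality amounts to surjectivity
      of the derivative.\<close>
    have "UNIV = {a + b |a b. a \<in> range (DF g x) \<and> b \<in> tangent_space M (g x)}"
      unfolding T using A by auto
    then show "\<exists>V. open V \<and> x \<in> V \<and> V \<subseteq> U \<and>
      C1F_submanifold_codim (V \<inter> {u \<in> U. g u \<in> M}) m \<and>
      tangent_space ({u \<in> U. g u \<in> M} \<inter> V) x = DF g x -` {0}"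
      using main[of M m] A C1F_submanifold_codim_singleton[of m "g x"] unfolding T by auto
  }
qed

end
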